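(* Let $N\in\mathbb N$, $\alpha\in(0,N)$ and $p\ge1$. Assume that $(u_n)_{n\in\mathbb N}$ is a sequence of measurable functions from $\mathbb R^N$ to $\mathbb R$ that converges to $u:\mathbb R^N\to\mathbb R$ almost everywhere. If the sequence $(I_{\alpha/2}*|u_n|^p)_{n\in\mathbb N}$ is bounded in $L^2(\mathbb R^N)$ and if there exists $q>p$ such that the sequence $(u_n)_{n\in\mathbb N}$ is bounded in $L^q_{\mathrm{loc}}(\mathbb R^N)$, then $(I_{\alpha/2}*|u_n|^p)_{n\in\mathbb N}$ converges weakly to $I_{\alpha/2}*|u|^p$ in $L^2(\mathbb R^N)$ and $$\lim_{n\to\infty}\int_{\mathbb R^N}\Bigl|\,\bigl|I_{\alpha/2}*|u_n|^p\bigr|^2-\bigl|I_{\alpha/2}*|u_n-u|^p\bigr|^2\Bigr|=\int_{\mathbb R^N}\bigl|I_{\alpha/2}*|u|^p\bigr|^2.$$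
   Context: $\mathbb N$ denotes the positive integers. For $\alpha\in(0,N)$ the Riesz potential is $I_\alpha(x)=A_\alpha|x|^{-(N-\alpha)}$ for $x\in\mathbb R^N\setminus\{0\}$, with $A_\alpha=\frac{\Gamma((N-\alpha)/2)}{\Gamma(\alpha/2)\pi^{N/2}2^\alpha}$. Bounded in $L^q_{\mathrm{loc}}(\mathbb R^N)$ means $\sup_n\int_K|u_n|^q<\infty$ for every compact $K\subset\mathbb R^N$. *)

theory Defs
  imports "HOL-Analysis.Analysis"
begin

definition riesz_const :: "nat \<Rightarrow> real \<Rightarrow> real" where
  "riesz_const N \<alpha> =
     Gamma ((real N - \<alpha>) / 2) / (Gamma (\<alpha> / 2) * pi powr (real N / 2) * 2 powr \<alpha>)"

text \<open>At the origin, where the Riesz kernel is not defined, this takes the value 0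
  (since \<open>0 powr a = 0\<close>); the origin is a null set.\<close>

definition riesz_kernel :: "real \<Rightarrow> 'a::euclidean_space \<Rightarrow> real" where
  "riesz_kernel \<alpha> x = riesz_const DIM('a) \<alpha> * norm x powr (- (real DIM('a) - \<alpha>))"

text \<open>Convolution of two nonnegative functions. The values lie in \<open>[0, \<infinity>]\<close>, so a divergent
  integral is \<open>\<infinity>\<close> rather than the junk value 0 of the Bochner integral.\<close>

definition nonneg_conv ::
    "('a::euclidean_space \<Rightarrow> real) \<Rightarrow> ('a \<Rightarrow> real) \<Rightarrow> 'a \<Rightarrow> ennreal" where
  "nonneg_conv k f x = (\<integral>\<^sup>+ y. ennreal (k (x - y)) * ennreal (f y) \<partial>lebesgue)"

definition L2_real :: "('a::euclidean_space \<Rightarrow> real) set" where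
  "L2_real = {f \<in> borel_measurable lebesgue. integrable lebesgue (\<lambda>x. (f x)\<^sup>2)}"

text \<open>Nonnegative square-integrable functions with values in \<open>[0, \<infinity>]\<close>; they are finite
  almost everywhere, so that \<open>enn2real \<circ> f\<close> is a real-valued representative.\<close>

definition L2_ennreal :: "('a::euclidean_space \<Rightarrow> ennreal) set" where
  "L2_ennreal = {f \<in> borel_measurable lebesgue. (\<integral>\<^sup>+ x. (f x)\<^sup>2 \<partial>lebesgue) < \<infinity>}"

definition bounded_in_L2 :: "(nat \<Rightarrow> 'a::euclidean_space \<Rightarrow> ennreal) \<Rightarrow> bool" where
  "bounded_in_L2 f \<longleftrightarrow>
     (\<forall>n. f n \<in> L2_ennreal) \<and> (SUP n. \<integral>\<^sup>+ x. (f n x)\<^sup>2 \<partial>lebesgue) < \<infinity>"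

definition weakly_converges_L2 ::
    "(nat \<Rightarrow> 'a::euclidean_space \<Rightarrow> ennreal) \<Rightarrow> ('a \<Rightarrow> ennreal) \<Rightarrow> bool" where
  "weakly_converges_L2 f g \<longleftrightarrow>
     (\<forall>n. f n \<in> L2_ennreal) \<and> g \<in> L2_ennreal \<and>
     (\<forall>\<phi>\<in>L2_real. (\<lambda>n. \<integral>x. enn2real (f n x) * \<phi> x \<partial>lebesgue)
        \<longlonglongrightarrow> (\<integral>x. enn2real (g x) * \<phi> x \<partial>lebesgue))"

definition bounded_in_Lq_loc ::
    "real \<Rightarrow> (nat \<Rightarrow> 'a::euclidean_space \<Rightarrow> real) \<Rightarrow> bool" where
  "bounded_in_Lq_loc q u \<longleftrightarrow>
     (\<forall>K. compact K \<longrightarrow> (SUP n. \<integral>\<^sup>+ x\<in>K. ennreal (\<bar>u n x\<bar> powr q) \<partial>lebesgue) < \<infinity>)"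

text \<open>The distance \<open>\<bar>a - b\<bar>\<close> in \<open>[0, \<infinity>]\<close>: subtraction on \<^typ>\<open>ennreal\<close> is truncated at 0, so
  one of the two summands vanishes unless \<open>a = b = \<infinity>\<close>, where the result is \<open>\<infinity>\<close>.\<close>

definition ennreal_absdiff :: "ennreal \<Rightarrow> ennreal \<Rightarrow> ennreal" where
  "ennreal_absdiff a b = (a - b) + (b - a)"

end

theory Submission
  imports Defs
begin

text \<open>Write \<open>T h\<close> for the Riesz potential of order \<open>\<alpha> / 2\<close> of \<open>h \<ge> 0\<close>, and put
  \<open>a = T \<bar>u\<^sub>n\<bar>\<^sup>p\<close>, \<open>b = T \<bar>u\<^sub>n - v\<bar>\<^sup>p\<close>, \<open>c = T \<bar>v\<bar>\<^sup>p\<close> and \<open>e = T \<bar>\<bar>u\<^sub>n\<bar>\<^sup>p - \<bar>v\<bar>\<^sup>p - \<bar>u\<^sub>n - v\<bar>\<^sup>p\<bar>\<close>.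
  Since \<open>T\<close> is linear and monotone, \<open>\<bar>a - b - c\<bar> \<le> e\<close>. Both claims follow from two facts: \<open>e\<close> tends
  to zero strongly in \<open>L\<^sup>2\<close>, and \<open>b\<close> tends to zero weakly in \<open>L\<^sup>2\<close>. Indeed \<open>\<bar>a - c\<bar> \<le> b + e\<close> then gives
  the weak convergence of \<open>a\<close> to \<open>c\<close>, and in \<open>\<bar>a\<^sup>2 - b\<^sup>2\<bar> = \<bar>a - b\<bar> (a + b)\<close> every term other than
  \<open>c\<^sup>2\<close> contains either the factor \<open>e\<close> or the product \<open>c b\<close>, whose integrals tend to zero
  (lemmas \<open>weak_limit_if_remainders_null\<close> and \<open>nn_integral_absdiff_power2_tendsto\<close>). That \<open>c\<close> lies
  in \<open>L\<^sup>2\<close> and that \<open>b\<close> stays bounded there is Fatou's lemma together with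
  \<open>\<bar>u\<^sub>n - v\<bar>\<^sup>p \<le> 2\<^sup>p (\<bar>u\<^sub>n\<bar>\<^sup>p + \<bar>v\<bar>\<^sup>p)\<close>.

  The strong convergence of \<open>e\<close> is the argument of Brezis and Lieb carried through the
  convolution: the defect is at most \<open>\<epsilon> \<bar>u\<^sub>n - v\<bar>\<^sup>p\<close> plus a function dominated by a multiple of
  \<open>\<bar>v\<bar>\<^sup>p\<close> (lemma \<open>riesz_potential_powr_defect_tendsto_0\<close>).

  The weak convergence of \<open>b\<close> is where the local bound in \<open>L\<^sup>q\<close> enters. As \<open>b\<close> is bounded in
  \<open>L\<^sup>2\<close>, it is enough that its integral over every ball tends to zero. The local bound makes
  \<open>\<bar>u\<^sub>n - v\<bar>\<^sup>p\<close> tend to zero in \<open>L\<^sup>1\<close> on every ball, and by Tonelli's theorem and the local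
  integrability of the kernel this settles the contribution of any fixed ball to \<open>b\<close>. What
  the complement of a large ball contributes to \<open>b\<close> on the fixed ball is, up to a constant factor,
  at most the value of \<open>b\<close> at every single point of the large ball, so the bound in \<open>L\<^sup>2\<close> makes it
  small uniformly in \<open>n\<close> (lemma \<open>riesz_potential_locally_null\<close>).\<close>

section \<open>Null sequences and weak convergence in \<open>[0, \<infinity>]\<close>\<close>

lemma tendsto_0_ennreal_if_le_small_plus_null:
  fixes X :: "nat \<Rightarrow> ennreal"
  assumes "\<And>e::real. e > 0 \<Longrightarrow> \<exists>Y. Y \<longlonglongrightarrow> 0 \<and> (\<forall>n. X n \<le> ennreal e + Y n)"
  shows "X \<longlonglongrightarrow> 0"
proof (rule tendsto_zero_ennreal)
  fix r :: real assume r: "r > 0"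
  obtain Y where Y: "Y \<longlonglongrightarrow> 0" and le: "\<And>n. X n \<le> ennreal (r/2) + Y n"
    using assms[of "r/2"] r by auto
  have "eventually (\<lambda>n. Y n < ennreal (r/2)) sequentially"
    by (rule order_tendstoD[OF Y]) (use r in auto)
  then show "eventually (\<lambda>n. X n < ennreal r) sequentially"
  proof eventually_elim
    case (elim n)
    have "X n \<le> ennreal (r/2) + Y n" by (rule le)
    also have "\<dots> < ennreal (r/2) + ennreal (r/2)"
      using elim by (intro ennreal_add_left_cancel_less[THEN iffD2]) auto
    also have "\<dots> = ennreal r" using r by (simp flip: ennreal_plus)
    finally show ?case .
  qed
qed

lemma ennreal_le_if_power2_le:
  fixes x y :: ennreal
  assumes "x\<^sup>2 \<le> y\<^sup>2"
  shows "x \<le> y"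
proof (rule ccontr)
  assume "\<not> x \<le> y"
  then have xy: "y < x" by simp
  then obtain b where b: "y = ennreal b" "b \<ge> 0" by (cases y) auto
  show False
  proof (cases x)
    case (real a)
    then show False using assms b xy
      by (auto simp: ennreal_power ennreal_less_iff power2_le_iff_abs_le)
  next
    case top
    then show False using assms b by (simp add: ennreal_power top_unique)
  qed
qed

lemma tendsto_0_ennreal_if_power2_tendsto_0:
  fixes X :: "nat \<Rightarrow> ennreal"
  assumes "(\<lambda>n. (X n)\<^sup>2) \<longlonglongrightarrow> 0"
  shows "X \<longlonglongrightarrow> 0"
proof (rule tendsto_zero_ennreal)
  fix r :: real assume r: "r > 0"
  have "eventually (\<lambda>n. (X n)\<^sup>2 < (ennreal r)\<^sup>2) sequentially"
    by (rule order_tendstoD[OF assms]) (use r in \<open>auto simp: ennreal_power\<close>)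
  then show "eventually (\<lambda>n. X n < ennreal r) sequentially"
    by eventually_elim (metis linorder_not_le power_mono zero_le)
qed

lemma nn_integral_mult_tendsto_0:
  fixes e b :: "nat \<Rightarrow> 'a \<Rightarrow> ennreal"
  assumes [measurable]: "\<And>n. e n \<in> borel_measurable M" "\<And>n. b n \<in> borel_measurable M"
    and e: "(\<lambda>n. \<integral>\<^sup>+x. (e n x)\<^sup>2 \<partial>M) \<longlonglongrightarrow> 0"
    and b: "\<And>n. (\<integral>\<^sup>+x. (b n x)\<^sup>2 \<partial>M) \<le> C" and C: "C < \<infinity>"
  shows "(\<lambda>n. \<integral>\<^sup>+x. e n x * b n x \<partial>M) \<longlonglongrightarrow> 0"
proof (rule tendsto_0_ennreal_if_power2_tendsto_0, rule tendsto_sandwich[OF _ _ tendsto_const])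
  show "eventually (\<lambda>n. (\<integral>\<^sup>+x. e n x * b n x \<partial>M)\<^sup>2 \<le> C * (\<integral>\<^sup>+x. (e n x)\<^sup>2 \<partial>M)) sequentially"
  proof (intro always_eventually allI)
    fix n
    have "(\<integral>\<^sup>+x. e n x * b n x \<partial>M)\<^sup>2 \<le> (\<integral>\<^sup>+x. (e n x)\<^sup>2 \<partial>M) * (\<integral>\<^sup>+x. (b n x)\<^sup>2 \<partial>M)"
      by (rule Cauchy_Schwarz_nn_integral) auto
    also have "\<dots> \<le> (\<integral>\<^sup>+x. (e n x)\<^sup>2 \<partial>M) * C" by (intro mult_left_mono b) auto
    finally show "(\<integral>\<^sup>+x. e n x * b n x \<partial>M)\<^sup>2 \<le> C * (\<integral>\<^sup>+x. (e n x)\<^sup>2 \<partial>M)"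
      by (simp add: mult.commute)
  qed
  show "(\<lambda>n. C * (\<integral>\<^sup>+x. (e n x)\<^sup>2 \<partial>M)) \<longlonglongrightarrow> 0"
    using ennreal_tendsto_cmult[OF _ e, of C] C by simp
qed auto

text \<open>A bounded sequence only needs to be tested against a dense set; here the dense set
  consists of the functions that are bounded and supported in some \<open>A m\<close>. The test function is
  truncated in both domain and height, and the Cauchy--Schwarz inequality controls what is cut
  off uniformly in \<open>n\<close>.\<close>

lemma weakly_null_if_locally_null:
  fixes h :: "nat \<Rightarrow> 'a \<Rightarrow> ennreal" and A :: "nat \<Rightarrow> 'a set"
  assumes [measurable]: "\<And>n. h n \<in> borel_measurable M" "\<And>m. A m \<in> sets M"
      "\<phi> \<in> borel_measurable M"
    and h: "\<And>n. (\<integral>\<^sup>+x. (h n x)\<^sup>2 \<partial>M) \<le> C" and C: "C < \<infinity>"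
    and A: "\<And>x. x \<in> space M \<Longrightarrow> eventually (\<lambda>m. x \<in> A m) sequentially"
    and loc: "\<And>m. (\<lambda>n. \<integral>\<^sup>+x. h n x * indicator (A m) x \<partial>M) \<longlonglongrightarrow> 0"
    and \<phi>: "(\<integral>\<^sup>+x. (\<phi> x)\<^sup>2 \<partial>M) < \<infinity>"
  shows "(\<lambda>n. \<integral>\<^sup>+x. \<phi> x * h n x \<partial>M) \<longlonglongrightarrow> 0"
proof (rule tendsto_0_ennreal_if_le_small_plus_null)
  fix r :: real assume r: "r > 0"
  define \<psi> where "\<psi> m x = (if x \<in> A m \<and> \<phi> x \<le> of_nat m then 0 else \<phi> x)" for m :: nat and x
  have [measurable]: "\<psi> m \<in> borel_measurable M" for m unfolding \<psi>_def by measurable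
  have "(\<lambda>m. \<integral>\<^sup>+x. (\<psi> m x)\<^sup>2 \<partial>M) \<longlonglongrightarrow> (\<integral>\<^sup>+x. 0 \<partial>M)"
  proof (rule nn_integral_dominated_convergence[where w = "\<lambda>x. (\<phi> x)\<^sup>2"])
    show "AE x in M. (\<psi> j x)\<^sup>2 \<le> (\<phi> x)\<^sup>2" for j by (auto simp: \<psi>_def)
    have "AE x in M. (\<phi> x)\<^sup>2 \<noteq> \<infinity>" using \<phi> by (intro nn_integral_PInf_AE) auto
    then show "AE x in M. (\<lambda>i. (\<psi> i x)\<^sup>2) \<longlonglongrightarrow> 0"
      using AE_space
    proof eventually_elim
      case (elim x)
      then have "\<phi> x < top" by (simp add: less_top power_less_top_ennreal)
      then obtain k where k: "\<phi> x < of_nat k"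
        using ennreal_Ex_less_of_nat by blast
      have "eventually (\<lambda>i. (\<psi> i x)\<^sup>2 = 0) sequentially"
        using A[OF elim(2)] eventually_ge_at_top[of k]
      proof eventually_elim
        case (elim i)
        have "\<phi> x \<le> of_nat i" using k elim(2) by (meson less_imp_le of_nat_mono order_trans)
        with elim show ?case by (simp add: \<psi>_def)
      qed
      then show ?case by (rule tendsto_eventually)
    qed
  qed (use \<phi> in auto)
  then have "(\<lambda>m. C * (\<integral>\<^sup>+x. (\<psi> m x)\<^sup>2 \<partial>M)) \<longlonglongrightarrow> 0"
    using ennreal_tendsto_cmult[of C] C by fastforce
  then have "eventually (\<lambda>m. C * (\<integral>\<^sup>+x. (\<psi> m x)\<^sup>2 \<partial>M) < (ennreal r)\<^sup>2) sequentially"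
    by (rule order_tendstoD) (use r in \<open>auto simp: ennreal_power\<close>)
  then obtain m where m: "C * (\<integral>\<^sup>+x. (\<psi> m x)\<^sup>2 \<partial>M) < (ennreal r)\<^sup>2"
    by (auto simp: eventually_sequentially)
  define Y where "Y n = of_nat m * (\<integral>\<^sup>+x. h n x * indicator (A m) x \<partial>M)" for n
  have "Y \<longlonglongrightarrow> 0"
    unfolding Y_def using ennreal_tendsto_cmult[OF of_nat_less_top loc, of m m] by simp
  moreover have "(\<integral>\<^sup>+x. \<phi> x * h n x \<partial>M) \<le> ennreal r + Y n" for n
  proof -
    have "(\<integral>\<^sup>+x. \<psi> m x * h n x \<partial>M)\<^sup>2 \<le> (\<integral>\<^sup>+x. (\<psi> m x)\<^sup>2 \<partial>M) * (\<integral>\<^sup>+x. (h n x)\<^sup>2 \<partial>M)"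
      by (rule Cauchy_Schwarz_nn_integral) auto
    also have "\<dots> \<le> (\<integral>\<^sup>+x. (\<psi> m x)\<^sup>2 \<partial>M) * C" by (intro mult_left_mono h) auto
    also have "\<dots> \<le> (ennreal r)\<^sup>2" using m by (simp add: mult.commute)
    finally have 1: "(\<integral>\<^sup>+x. \<psi> m x * h n x \<partial>M) \<le> ennreal r" by (rule ennreal_le_if_power2_le)
    have "(\<integral>\<^sup>+x. \<phi> x * h n x \<partial>M)
        \<le> (\<integral>\<^sup>+x. \<psi> m x * h n x + of_nat m * (h n x * indicator (A m) x) \<partial>M)"
      by (intro nn_integral_mono)
         (auto simp: \<psi>_def indicator_def intro: mult_right_mono add_increasing2)
    also have "\<dots> = (\<integral>\<^sup>+x. \<psi> m x * h n x \<partial>M) + Y n"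
      unfolding Y_def by (subst nn_integral_add) (auto simp: nn_integral_cmult)
    also have "\<dots> \<le> ennreal r + Y n" by (intro add_right_mono 1)
    finally show ?thesis .
  qed
  ultimately show "\<exists>Y. Y \<longlonglongrightarrow> 0 \<and> (\<forall>n. (\<integral>\<^sup>+x. \<phi> x * h n x \<partial>M) \<le> ennreal r + Y n)" by blast
qed

section \<open>The Riesz kernel\<close>

lemma riesz_const_nonneg:
  assumes "0 < \<beta>" "\<beta> < real N"
  shows "riesz_const N \<beta> \<ge> 0"
  unfolding riesz_const_def using assms
  by (intro divide_nonneg_pos mult_pos_pos Gamma_real_pos less_imp_le[OF Gamma_real_pos]) auto

lemma borel_measurable_riesz_kernel [measurable]: "riesz_kernel \<beta> \<in> borel_measurable borel"
  unfolding riesz_kernel_def by measurable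

lemma riesz_kernel_nonneg:
  fixes x :: "'a::euclidean_space"
  assumes "0 < \<beta>" "\<beta> < real DIM('a)"
  shows "riesz_kernel \<beta> x \<ge> 0"
  unfolding riesz_kernel_def using riesz_const_nonneg[OF assms] by simp

lemma ex_dyadic_scale:
  fixes t :: real
  assumes "0 < t" "t < 1"
  shows "\<exists>j. (1/2) ^ Suc j \<le> t \<and> t < (1/2) ^ j"
proof -
  define P where "P j \<longleftrightarrow> (1/2::real) ^ Suc j \<le> t" for j
  obtain n where "(1/2::real) ^ n < t" using real_arch_pow_inv[of t "1/2"] assms by auto
  moreover have "(1/2::real) ^ Suc n \<le> (1/2) ^ n" by simp
  ultimately have "P n" unfolding P_def by linarith
  define j where "j = (LEAST j. P j)"
  have "P j" unfolding j_def by (rule LeastI[of P, OF \<open>P n\<close>])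
  moreover have "t < (1/2) ^ j"
  proof (cases j)
    case (Suc i)
    then have "\<not> P i" using not_less_Least[of i P] by (simp add: j_def)
    then show ?thesis using Suc by (simp add: P_def)
  qed (use assms in simp)
  ultimately show ?thesis by (auto simp: P_def)
qed

text \<open>Near its singularity the kernel is at most a constant times \<open>2\<^bsup>j(N-\<beta>)\<^esup>\<close> on the dyadic annulus
  of radius \<open>2\<^bsup>-j\<^esup>\<close>, whose volume is of order \<open>2\<^bsup>-jN\<^esup>\<close>, so its integral is bounded by a geometric
  series of ratio \<open>2\<^bsup>-\<beta>\<^esup>\<close>. Away from the singularity the kernel is bounded.\<close>

lemma nn_integral_riesz_kernel_ball_bounded:
  assumes \<beta>: "0 < \<beta>" "\<beta> < real DIM('a::euclidean_space)" and R: "R > 0"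
  obtains S where "S < \<infinity>"
    "\<And>y::'a. (\<integral>\<^sup>+x. ennreal (riesz_kernel \<beta> (x - y)) * indicator (ball 0 R) x \<partial>lborel) \<le> S"
proof -
  define c where "c = riesz_const DIM('a) \<beta>"
  define s where "s = real DIM('a) - \<beta>"
  define \<omega> where "\<omega> = unit_ball_vol (real DIM('a))"
  have c: "c \<ge> 0" unfolding c_def by (rule riesz_const_nonneg[OF \<beta>])
  have s: "s > 0" using \<beta> by (simp add: s_def)
  have \<omega>: "\<omega> \<ge> 0" by (simp add: \<omega>_def)
  have [measurable]: "ball z \<rho> \<in> sets borel" for z :: 'a and \<rho> by simp
  define a where "a j = (2 powr s) ^ Suc j * (\<omega> * ((1/2) ^ j) ^ DIM('a))" for j
  define S where "S = ennreal c * (ennreal (\<omega> * R ^ DIM('a)) + (\<Sum>j. ennreal (a j)))"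
  have a_eq: "a j = 2 powr s * \<omega> * (2 powr (-\<beta>)) ^ j" for j
  proof -
    have "(2::real) powr (-\<beta>) = 2 powr s * (1/2) ^ DIM('a)"
      by (simp add: s_def powr_diff powr_minus powr_realpow divide_simps)
    then show ?thesis
      by (simp add: a_def power_mult_distrib mult_ac flip: power_mult)
  qed
  have "summable a"
    unfolding a_eq[abs_def] using \<beta>
    by (intro summable_mult summable_geometric) (simp add: powr_less_one)
  moreover have "a j \<ge> 0" for j using \<omega> by (simp add: a_eq)
  ultimately have "(\<Sum>j. ennreal (a j)) < \<infinity>"
    by (simp add: suminf_ennreal2)
  then have "S < \<infinity>" by (auto simp: S_def ennreal_mult_less_top)
  moreover have "(\<integral>\<^sup>+x. ennreal (riesz_kernel \<beta> (x - y)) * indicator (ball 0 R) x \<partial>lborel) \<le> S"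
    for y :: 'a
  proof -
    have pw: "ennreal (riesz_kernel \<beta> (x - y)) * indicator (ball 0 R) x
        \<le> ennreal c * (indicator (ball 0 R) x
            + (\<Sum>j. ennreal ((2 powr s) ^ Suc j) * indicator (ball y ((1/2) ^ j)) x))" for x :: 'a
    proof (cases "x \<in> ball 0 R")
      case True
      define t where "t = norm (x - y)"
      define q where "q j = ennreal ((2 powr s) ^ Suc j) * indicator (ball y ((1/2) ^ j)) x" for j
      define \<Sigma> where "\<Sigma> = (\<Sum>j. q j)"
      have "ennreal (t powr (-s)) \<le> 1 + \<Sigma>"
      proof -
        consider "t = 0" | "t \<ge> 1" | "0 < t" "t < 1" unfolding t_def using norm_ge_zero by fastforce
        then show ?thesis
        proof cases
          case 2
          then have "t powr (-s) \<le> 1 powr (-s)" using s by (intro powr_mono2') auto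
          then have "ennreal (t powr (-s)) \<le> 1" by simp
          then show ?thesis by (simp add: add_increasing2)
        next
          case 3
          then obtain j where j: "(1/2) ^ Suc j \<le> t" "t < (1/2) ^ j" using ex_dyadic_scale by blast
          have "t powr (-s) \<le> ((1/2) ^ Suc j) powr (-s)"
            using j s by (intro powr_mono2') auto
          also have "\<dots> = (2 powr s) ^ Suc j"
            by (simp add: powr_minus powr_realpow[symmetric] powr_powr powr_divide
                     divide_simps powr_add powr_mult mult_ac del: powr_realpow power_Suc)
          finally have "ennreal (t powr (-s)) \<le> q j"
            using j by (simp add: q_def t_def dist_norm norm_minus_commute ennreal_leI del: power_Suc)
          also have "\<dots> \<le> \<Sigma>"
            unfolding \<Sigma>_def using sum_le_suminf[OF summableI, of "{j}" q] by simp
          finally show ?thesis by (simp add: add_increasing)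
        qed simp
      qed
      then have "ennreal c * ennreal (t powr (-s)) \<le> ennreal c * (1 + \<Sigma>)"
        by (intro mult_left_mono) auto
      then show ?thesis
        using True c by (simp add: riesz_kernel_def ennreal_mult \<Sigma>_def q_def t_def c_def s_def)
    qed simp
    have "(\<integral>\<^sup>+x. ennreal (riesz_kernel \<beta> (x - y)) * indicator (ball 0 R) x \<partial>lborel)
      \<le> (\<integral>\<^sup>+x. ennreal c * (indicator (ball 0 R) x
            + (\<Sum>j. ennreal ((2 powr s) ^ Suc j) * indicator (ball y ((1/2) ^ j)) x)) \<partial>lborel)"
      by (intro nn_integral_mono pw)
    also have "\<dots> = ennreal c * (emeasure lborel (ball (0::'a) R)
        + (\<Sum>j. ennreal ((2 powr s) ^ Suc j) * emeasure lborel (ball y ((1/2) ^ j))))"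
      by (subst nn_integral_cmult, measurable, subst nn_integral_add, measurable,
          subst nn_integral_suminf, measurable)
         (simp add: nn_integral_cmult_indicator del: power_Suc)
    also have "\<dots> = S"
      using R \<omega> by (simp add: S_def emeasure_ball a_def \<omega>_def ennreal_mult)
    finally show ?thesis .
  qed
  ultimately show thesis using that by blast
qed

text \<open>A point outside \<open>ball 0 M\<close> is, up to a factor of 4, no closer to the points of
  \<open>ball 0 R\<close> than to those of \<open>ball 0 M\<close>, so its influence on the former is controlled by
  its influence at every point of the latter.\<close>

lemma riesz_kernel_far_le:
  fixes x x' y :: "'a::euclidean_space"
  assumes \<beta>: "0 < \<beta>" "\<beta> < real DIM('a)" and R: "0 < R" "2 * R \<le> M"
    and x: "x \<in> ball 0 R" and x': "x' \<in> ball 0 M" and y: "y \<notin> ball 0 M"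
  shows "riesz_kernel \<beta> (x - y) \<le> 4 powr (real DIM('a) - \<beta>) * riesz_kernel \<beta> (x' - y)"
proof -
  define s where "s = real DIM('a) - \<beta>"
  have s: "s > 0" using \<beta> by (simp add: s_def)
  have nx: "norm x < R" and nx': "norm x' < M" and ny: "M \<le> norm y"
    using x x' y by (auto simp: dist_norm)
  have pos: "norm (x' - y) > 0" using nx' ny by auto
  have "norm (x' - y) \<le> norm x' + norm y" by (rule norm_triangle_ineq4)
  moreover have "norm y - norm x \<le> norm (x - y)" by (metis norm_minus_commute norm_triangle_ineq2)
  ultimately have "norm (x' - y) / 4 \<le> norm (x - y)" using nx nx' ny R by linarith
  then have "norm (x - y) powr (-s) \<le> (norm (x' - y) / 4) powr (-s)"
    using pos s by (intro powr_mono2') auto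
  also have "\<dots> = 4 powr s * norm (x' - y) powr (-s)"
    by (simp add: powr_divide powr_minus divide_simps)
  finally have "norm (x - y) powr (-s) \<le> 4 powr s * norm (x' - y) powr (-s)" .
  then show ?thesis
    using mult_left_mono[OF _ riesz_const_nonneg[OF \<beta>]]
    by (fastforce simp: riesz_kernel_def s_def mult_ac)
qed

section \<open>The Riesz potential of functions with values in \<open>[0, \<infinity>]\<close>\<close>

text \<open>The integral is taken over \<open>lborel\<close> rather than its completion, so that Tonelli's theorem
  applies to Borel functions \<open>h\<close>; changing \<open>h\<close> on a null set does not change the potential.\<close>

definition riesz_potential :: "real \<Rightarrow> ('a::euclidean_space \<Rightarrow> ennreal) \<Rightarrow> 'a \<Rightarrow> ennreal" where
  "riesz_potential \<beta> h x = (\<integral>\<^sup>+y. ennreal (riesz_kernel \<beta> (x - y)) * h y \<partial>lborel)"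

lemma borel_measurable_riesz_potential [measurable]:
  assumes [measurable]: "h \<in> borel_measurable borel"
  shows "riesz_potential \<beta> h \<in> borel_measurable borel"
  unfolding riesz_potential_def by measurable

lemma riesz_potential_mono:
  assumes "\<And>y. h y \<le> h' y"
  shows "riesz_potential \<beta> h x \<le> riesz_potential \<beta> h' x"
  unfolding riesz_potential_def by (intro nn_integral_mono mult_left_mono assms) auto

lemma riesz_potential_add:
  assumes [measurable]: "h \<in> borel_measurable borel" "h' \<in> borel_measurable borel"
  shows "riesz_potential \<beta> (\<lambda>y. h y + h' y) x = riesz_potential \<beta> h x + riesz_potential \<beta> h' x"
  unfolding riesz_potential_def by (subst nn_integral_add[symmetric]) (auto simp: distrib_left)

lemma riesz_potential_cmult:
  assumes [measurable]: "h \<in> borel_measurable borel"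
  shows "riesz_potential \<beta> (\<lambda>y. c * h y) x = c * riesz_potential \<beta> h x"
  unfolding riesz_potential_def
  by (subst nn_integral_cmult[symmetric]) (auto simp: mult_ac)

lemma riesz_potential_le_liminf:
  assumes [measurable]: "\<And>n. h n \<in> borel_measurable borel" "h' \<in> borel_measurable borel"
    and lim: "AE y in lborel. (\<lambda>n. h n y) \<longlonglongrightarrow> h' y"
  shows "riesz_potential \<beta> h' x \<le> liminf (\<lambda>n. riesz_potential \<beta> (h n) x)"
proof -
  have "riesz_potential \<beta> h' x
      = (\<integral>\<^sup>+y. liminf (\<lambda>n. ennreal (riesz_kernel \<beta> (x - y)) * h n y) \<partial>lborel)"
    unfolding riesz_potential_def
  proof (rule nn_integral_cong_AE)
    show "AE y in lborel. ennreal (riesz_kernel \<beta> (x - y)) * h' y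
        = liminf (\<lambda>n. ennreal (riesz_kernel \<beta> (x - y)) * h n y)"
      using lim
      by eventually_elim
         (auto intro!: lim_imp_Liminf[symmetric] ennreal_tendsto_cmult)
  qed
  also have "\<dots> \<le> liminf (\<lambda>n. riesz_potential \<beta> (h n) x)"
    unfolding riesz_potential_def by (rule nn_integral_liminf) auto
  finally show ?thesis .
qed

text \<open>Fatou's lemma, applied in the convolution and once more in \<open>L\<^sup>2\<close>.\<close>

lemma nn_integral_riesz_potential_power2_le:
  assumes [measurable]: "\<And>n. h n \<in> borel_measurable borel" "h' \<in> borel_measurable borel"
    and lim: "AE y in lborel. (\<lambda>n. h n y) \<longlonglongrightarrow> h' y"
    and C: "\<And>n. (\<integral>\<^sup>+x. (riesz_potential \<beta> (h n) x)\<^sup>2 \<partial>lborel) \<le> C"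
  shows "(\<integral>\<^sup>+x. (riesz_potential \<beta> h' x)\<^sup>2 \<partial>lborel) \<le> C"
proof -
  have "(riesz_potential \<beta> h' x)\<^sup>2 \<le> liminf (\<lambda>n. (riesz_potential \<beta> (h n) x)\<^sup>2)" for x
  proof -
    have "(riesz_potential \<beta> h' x)\<^sup>2 \<le> (liminf (\<lambda>n. riesz_potential \<beta> (h n) x))\<^sup>2"
      by (intro power_mono riesz_potential_le_liminf lim) auto
    also have "\<dots> = liminf (\<lambda>n. (riesz_potential \<beta> (h n) x)\<^sup>2)"
      by (rule Liminf_compose_continuous_mono[symmetric])
         (auto intro!: mult_mono monoI tendsto_mult_ennreal simp: continuous_on_def power2_eq_square)
    finally show ?thesis .
  qed
  then have "(\<integral>\<^sup>+x. (riesz_potential \<beta> h' x)\<^sup>2 \<partial>lborel)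
      \<le> (\<integral>\<^sup>+x. liminf (\<lambda>n. (riesz_potential \<beta> (h n) x)\<^sup>2) \<partial>lborel)"
    by (intro nn_integral_mono)
  also have "\<dots> \<le> liminf (\<lambda>n. \<integral>\<^sup>+x. (riesz_potential \<beta> (h n) x)\<^sup>2 \<partial>lborel)"
    by (rule nn_integral_liminf) auto
  also have "\<dots> \<le> C"
    by (rule Liminf_le) (use C in auto)
  finally show ?thesis .
qed

text \<open>As \<open>riesz_potential \<beta> F\<close> is finite almost everywhere, it serves as the dominating function
  twice: its integrand for the convolution at almost every point, its square for the outer
  integral.\<close>

lemma riesz_potential_dominated_convergence:
  assumes [measurable]: "\<And>n. w n \<in> borel_measurable borel" "F \<in> borel_measurable borel"
    and le: "\<And>n y. w n y \<le> F y"
    and lim: "AE y in lborel. (\<lambda>n. w n y) \<longlonglongrightarrow> 0"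
    and F: "(\<integral>\<^sup>+x. (riesz_potential \<beta> F x)\<^sup>2 \<partial>lborel) < \<infinity>"
  shows "(\<lambda>n. \<integral>\<^sup>+x. (riesz_potential \<beta> (w n) x)\<^sup>2 \<partial>lborel) \<longlonglongrightarrow> 0"
proof -
  have "(\<lambda>n. \<integral>\<^sup>+x. (riesz_potential \<beta> (w n) x)\<^sup>2 \<partial>lborel) \<longlonglongrightarrow> (\<integral>\<^sup>+(x::'a). 0 \<partial>lborel)"
  proof (rule nn_integral_dominated_convergence[where w = "\<lambda>x. (riesz_potential \<beta> F x)\<^sup>2"])
    show "AE x in lborel. (riesz_potential \<beta> (w n) x)\<^sup>2 \<le> (riesz_potential \<beta> F x)\<^sup>2" for n
      by (intro AE_I2 power_mono riesz_potential_mono le) auto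
    have "AE x in lborel. (riesz_potential \<beta> F x)\<^sup>2 \<noteq> \<infinity>"
      using F by (intro nn_integral_PInf_AE) auto
    then show "AE x in lborel. (\<lambda>n. (riesz_potential \<beta> (w n) x)\<^sup>2) \<longlonglongrightarrow> 0"
    proof eventually_elim
      case (elim x)
      then have fin: "riesz_potential \<beta> F x < \<infinity>"
        by (simp add: less_top power_less_top_ennreal)
      have "(\<lambda>n. riesz_potential \<beta> (w n) x) \<longlonglongrightarrow> (\<integral>\<^sup>+(y::'a). 0 \<partial>lborel)"
        unfolding riesz_potential_def
      proof (rule nn_integral_dominated_convergence
          [where w = "\<lambda>y. ennreal (riesz_kernel \<beta> (x - y)) * F y"])
        show "AE y in lborel. ennreal (riesz_kernel \<beta> (x - y)) * w j y
            \<le> ennreal (riesz_kernel \<beta> (x - y)) * F y" for j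
          by (intro AE_I2 mult_left_mono le) auto
        show "AE y in lborel. (\<lambda>i. ennreal (riesz_kernel \<beta> (x - y)) * w i y) \<longlonglongrightarrow> 0"
          using lim
        proof eventually_elim
          case (elim y)
          then show ?case
            using ennreal_tendsto_cmult[OF _ elim, of "ennreal (riesz_kernel \<beta> (x - y))"] by simp
        qed
      qed (use fin in \<open>auto simp: riesz_potential_def\<close>)
      then have "(\<lambda>n. riesz_potential \<beta> (w n) x * riesz_potential \<beta> (w n) x) \<longlonglongrightarrow> 0 * 0"
        by (intro tendsto_mult_ennreal) auto
      then show ?case by (simp add: power2_eq_square)
    qed
  qed (use F in auto)
  then show ?thesis by simp
qed

text \<open>The mass of \<open>d n\<close> near the support of the test function is handled by the assumption on
  \<open>d n\<close>. What the mass outside a large ball \<open>ball 0 M\<close> contributes to the potential on \<open>ball 0 R\<close>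
  is, up to a constant factor, a lower bound for the potential on all of \<open>ball 0 M\<close>; as the
  potentials are bounded in \<open>L\<^sup>2\<close>, it is at most of the order of the inverse square root of the
  volume of \<open>ball 0 M\<close>, uniformly in \<open>n\<close>.\<close>

lemma riesz_potential_locally_null:
  fixes d :: "nat \<Rightarrow> 'a::euclidean_space \<Rightarrow> ennreal"
  assumes \<beta>: "0 < \<beta>" "\<beta> < real DIM('a)"
    and [measurable]: "\<And>n. d n \<in> borel_measurable borel"
    and bdd: "\<And>n. (\<integral>\<^sup>+x. (riesz_potential \<beta> (d n) x)\<^sup>2 \<partial>lborel) \<le> C" and C: "C < \<infinity>"
    and loc: "\<And>M. (\<lambda>n. \<integral>\<^sup>+y. d n y * indicator (ball 0 M) y \<partial>lborel) \<longlonglongrightarrow> 0"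
    and R: "R > 0"
  shows "(\<lambda>n. \<integral>\<^sup>+x. riesz_potential \<beta> (d n) x * indicator (ball 0 R) x \<partial>lborel) \<longlonglongrightarrow> 0"
proof (rule tendsto_0_ennreal_if_le_small_plus_null)
  fix r :: real assume r: "r > 0"
  define K where "K = 4 powr (real DIM('a) - \<beta>)"
  define \<omega> where "\<omega> = unit_ball_vol (real DIM('a))"
  have \<omega>: "\<omega> > 0" by (simp add: \<omega>_def)
  have K: "K \<ge> 0" by (simp add: K_def)
  have [measurable]: "ball z \<rho> \<in> sets borel" for z :: 'a and \<rho> by simp
  define D where "D = (ennreal (\<omega> * R ^ DIM('a)) * ennreal K)\<^sup>2 * C"
  have "D < \<infinity>" using C by (auto simp: D_def ennreal_mult_less_top power2_eq_square)
  then obtain D' where D': "D = ennreal D'" "D' \<ge> 0" by (cases D) auto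
  \<comment> \<open>The volume of \<open>ball 0 M\<close> is at least \<open>\<omega> * M\<close>, which exceeds \<open>D' / r\<^sup>2\<close>.\<close>
  define M where "M = max (max 1 (2 * R)) ((D' + 1) / (r\<^sup>2 * \<omega>))"
  have M: "M \<ge> 1" "2 * R \<le> M" by (auto simp: M_def)
  define far where "far n = (\<lambda>y. d n y * indicator (- ball 0 M) y)" for n
  define near where "near n = (\<lambda>y. d n y * indicator (ball 0 M) y)" for n
  have [measurable]: "far n \<in> borel_measurable borel" "near n \<in> borel_measurable borel" for n
    unfolding far_def near_def by measurable
  obtain S where S: "S < \<infinity>" and S_bound:
    "\<And>y::'a. (\<integral>\<^sup>+x. ennreal (riesz_kernel \<beta> (x - y)) * indicator (ball 0 R) x \<partial>lborel) \<le> S"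
    using nn_integral_riesz_kernel_ball_bounded[OF \<beta> R] by blast

  have far_le: "(\<integral>\<^sup>+x. riesz_potential \<beta> (far n) x * indicator (ball 0 R) x \<partial>lborel) \<le> ennreal r" for n
  proof (rule ccontr)
    define F where "F = (\<integral>\<^sup>+x. riesz_potential \<beta> (far n) x * indicator (ball 0 R) x \<partial>lborel)"
    assume "\<not> F \<le> ennreal r"
    then have F: "ennreal r \<le> F" by simp
    have F_le: "F \<le> ennreal (\<omega> * R ^ DIM('a)) * ennreal K * riesz_potential \<beta> (d n) x'"
      if x': "x' \<in> ball 0 M" for x'
    proof -
      have "F \<le> (\<integral>\<^sup>+x. (ennreal K * riesz_potential \<beta> (d n) x') * indicator (ball (0::'a) R) x \<partial>lborel)"
        unfolding F_def
      proof (intro nn_integral_mono)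
        fix x :: 'a
        show "riesz_potential \<beta> (far n) x * indicator (ball 0 R) x
            \<le> ennreal K * riesz_potential \<beta> (d n) x' * indicator (ball 0 R) x"
        proof (cases "x \<in> ball 0 R")
          case x: True
          have "riesz_potential \<beta> (far n) x
              \<le> (\<integral>\<^sup>+y. ennreal K * (ennreal (riesz_kernel \<beta> (x' - y)) * d n y) \<partial>lborel)"
            unfolding riesz_potential_def far_def
          proof (intro nn_integral_mono)
            fix y
            show "ennreal (riesz_kernel \<beta> (x - y)) * (d n y * indicator (- ball 0 M) y)
                \<le> ennreal K * (ennreal (riesz_kernel \<beta> (x' - y)) * d n y)"
            proof (cases "y \<in> ball 0 M")
              case False
              have "ennreal (riesz_kernel \<beta> (x - y)) \<le> ennreal K * ennreal (riesz_kernel \<beta> (x' - y))"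
                using riesz_kernel_far_le[OF \<beta> R M(2) x x' False] K riesz_kernel_nonneg[OF \<beta>]
                by (simp add: K_def flip: ennreal_mult)
              from mult_right_mono[OF this, of "d n y"] False show ?thesis
                by (simp add: mult.assoc)
            qed simp
          qed
          then show ?thesis using x
            by (simp add: nn_integral_cmult riesz_potential_def)
        qed simp
      qed
      also have "\<dots> = ennreal (\<omega> * R ^ DIM('a)) * ennreal K * riesz_potential \<beta> (d n) x'"
        using R by (subst nn_integral_cmult_indicator) (auto simp: emeasure_ball \<omega>_def mult_ac)
      finally show ?thesis .
    qed
    have "(ennreal r)\<^sup>2 * emeasure lborel (ball (0::'a) M)
        = (\<integral>\<^sup>+x'. (ennreal r)\<^sup>2 * indicator (ball (0::'a) M) x' \<partial>lborel)"
      by (simp add: nn_integral_cmult_indicator)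
    also have "\<dots> \<le> (\<integral>\<^sup>+x'. (ennreal (\<omega> * R ^ DIM('a)) * ennreal K)\<^sup>2
        * (riesz_potential \<beta> (d n) x')\<^sup>2 \<partial>lborel)"
    proof (intro nn_integral_mono)
      fix x' :: 'a
      show "(ennreal r)\<^sup>2 * indicator (ball 0 M) x'
          \<le> (ennreal (\<omega> * R ^ DIM('a)) * ennreal K)\<^sup>2 * (riesz_potential \<beta> (d n) x')\<^sup>2"
      proof (cases "x' \<in> ball 0 M")
        case True
        then show ?thesis
          using power_mono[OF order_trans[OF F F_le[OF True]], of 2] by (simp add: power_mult_distrib)
      qed simp
    qed
    also have "\<dots> \<le> D"
      unfolding D_def by (subst nn_integral_cmult) (auto intro!: mult_left_mono bdd)
    finally have "r\<^sup>2 * (\<omega> * M ^ DIM('a)) \<le> D'"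
      using r M \<omega> D' by (simp add: emeasure_ball \<omega>_def[symmetric] ennreal_power flip: ennreal_mult)
    moreover have "M ^ 1 \<le> M ^ DIM('a)"
      using M(1) by (intro power_increasing) (auto simp: Suc_leI)
    then have "r\<^sup>2 * (\<omega> * M) \<le> r\<^sup>2 * (\<omega> * M ^ DIM('a))"
      using \<omega> by (intro mult_left_mono) auto
    moreover have "(D' + 1) / (r\<^sup>2 * \<omega>) \<le> M" by (simp add: M_def)
    then have "D' + 1 \<le> r\<^sup>2 * (\<omega> * M)"
      using r \<omega> by (simp add: pos_divide_le_eq mult_ac)
    ultimately show False by linarith
  qed

  have near_le: "(\<integral>\<^sup>+x. riesz_potential \<beta> (near n) x * indicator (ball 0 R) x \<partial>lborel)
      \<le> S * (\<integral>\<^sup>+y. d n y * indicator (ball 0 M) y \<partial>lborel)" for n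
  proof -
    have "(\<integral>\<^sup>+x. riesz_potential \<beta> (near n) x * indicator (ball 0 R) x \<partial>lborel)
      = (\<integral>\<^sup>+x. \<integral>\<^sup>+y. ennreal (riesz_kernel \<beta> (x - y)) * near n y * indicator (ball 0 R) x \<partial>lborel \<partial>lborel)"
      unfolding riesz_potential_def by (simp add: nn_integral_multc)
    also have "\<dots> = (\<integral>\<^sup>+y. \<integral>\<^sup>+x. ennreal (riesz_kernel \<beta> (x - y)) * near n y * indicator (ball 0 R) x \<partial>lborel \<partial>lborel)"
      by (rule lborel_pair.Fubini'[symmetric]) measurable
    also have "\<dots> = (\<integral>\<^sup>+y. near n y *
        (\<integral>\<^sup>+x. ennreal (riesz_kernel \<beta> (x - y)) * indicator (ball 0 R) x \<partial>lborel) \<partial>lborel)"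
      by (subst nn_integral_cmult[symmetric]) (auto simp: mult_ac)
    also have "\<dots> \<le> (\<integral>\<^sup>+y. S * near n y \<partial>lborel)"
      by (intro nn_integral_mono) (metis S_bound mult.commute mult_left_mono zero_le)
    also have "\<dots> = S * (\<integral>\<^sup>+y. d n y * indicator (ball 0 M) y \<partial>lborel)"
      by (simp add: nn_integral_cmult near_def)
    finally show ?thesis .
  qed

  define Y where "Y n = S * (\<integral>\<^sup>+y. d n y * indicator (ball 0 M) y \<partial>lborel)" for n
  have "Y \<longlonglongrightarrow> 0"
    unfolding Y_def using ennreal_tendsto_cmult[OF _ loc[of M], of S] S by simp
  moreover have "(\<integral>\<^sup>+x. riesz_potential \<beta> (d n) x * indicator (ball 0 R) x \<partial>lborel) \<le> ennreal r + Y n" for n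
  proof -
    have "d n = (\<lambda>y. far n y + near n y)"
      by (auto simp: far_def near_def indicator_def fun_eq_iff)
    then have "riesz_potential \<beta> (d n) x = riesz_potential \<beta> (far n) x + riesz_potential \<beta> (near n) x" for x
      using riesz_potential_add[of "far n" "near n" \<beta> x] by simp
    then have "(\<integral>\<^sup>+x. riesz_potential \<beta> (d n) x * indicator (ball 0 R) x \<partial>lborel)
      = (\<integral>\<^sup>+x. riesz_potential \<beta> (far n) x * indicator (ball 0 R) x \<partial>lborel)
        + (\<integral>\<^sup>+x. riesz_potential \<beta> (near n) x * indicator (ball 0 R) x \<partial>lborel)"
      by (subst nn_integral_add[symmetric]) (auto simp: distrib_right)
    also have "\<dots> \<le> ennreal r + Y n"
      unfolding Y_def by (intro add_mono far_le near_le)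
    finally show ?thesis .
  qed
  ultimately show "\<exists>Y. Y \<longlonglongrightarrow> 0 \<and> (\<forall>n. (\<integral>\<^sup>+x. riesz_potential \<beta> (d n) x * indicator (ball 0 R) x \<partial>lborel)
      \<le> ennreal r + Y n)" by blast
qed

section \<open>Elementary inequalities for powers\<close>

text \<open>By homogeneity the comparison of \<open>\<bar>a + b\<bar> powr p\<close> with \<open>\<bar>a\<bar> powr p\<close> only depends on
  \<open>b / a\<close>. When this ratio is small, continuity of \<open>t \<mapsto> \<bar>1 + t\<bar> powr p\<close> at 0 gives the factor
  \<open>\<epsilon>\<close>; otherwise all terms are at most a multiple of \<open>\<bar>b\<bar> powr p\<close>.\<close>

lemma powr_add_defect_le:
  fixes p \<epsilon> :: real
  assumes p: "p > 0" and \<epsilon>: "\<epsilon> > 0"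
  obtains C where "C \<ge> 0"
    "\<And>a b::real. \<bar>\<bar>a + b\<bar> powr p - \<bar>b\<bar> powr p - \<bar>a\<bar> powr p\<bar> \<le> \<epsilon> * \<bar>a\<bar> powr p + C * \<bar>b\<bar> powr p"
proof -
  have "((\<lambda>t::real. \<bar>1 + t\<bar> powr p) \<longlongrightarrow> \<bar>1 + 0\<bar> powr p) (nhds 0)"
    by (intro tendsto_intros filterlim_ident) auto
  then have "eventually (\<lambda>t::real. dist (\<bar>1 + t\<bar> powr p) 1 < \<epsilon>) (nhds 0)"
    using \<epsilon> by (auto dest: tendstoD)
  then obtain \<delta> where \<delta>: "\<delta> > 0" and small: "\<And>t. \<bar>t\<bar> < \<delta> \<Longrightarrow> \<bar>\<bar>1 + t\<bar> powr p - 1\<bar> < \<epsilon>"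
    unfolding eventually_nhds_metric by (auto simp: dist_real_def)
  define C where "C = (1 + 1/\<delta>) powr p + (1/\<delta>) powr p + 1"
  show thesis
  proof (rule that[of C])
    show "C \<ge> 0" by (simp add: C_def)
    fix a b :: real
    show "\<bar>\<bar>a + b\<bar> powr p - \<bar>b\<bar> powr p - \<bar>a\<bar> powr p\<bar> \<le> \<epsilon> * \<bar>a\<bar> powr p + C * \<bar>b\<bar> powr p"
    proof (cases "\<bar>b\<bar> < \<delta> * \<bar>a\<bar>")
      case True
      then have a: "a \<noteq> 0" by auto
      have "\<bar>b / a\<bar> < \<delta>" using True a by (subst abs_divide, subst pos_divide_less_eq) (auto simp: mult.commute)
      then have "\<bar>\<bar>1 + b / a\<bar> powr p - 1\<bar> < \<epsilon>" by (rule small)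
      then have "\<bar>\<bar>1 + b / a\<bar> powr p - 1\<bar> * \<bar>a\<bar> powr p \<le> \<epsilon> * \<bar>a\<bar> powr p"
        by (meson less_imp_le mult_right_mono powr_ge_zero)
      moreover have "\<bar>a + b\<bar> powr p = \<bar>1 + b / a\<bar> powr p * \<bar>a\<bar> powr p"
      proof -
        have "a + b = (1 + b / a) * a" using a by (simp add: distrib_right)
        then have "\<bar>a + b\<bar> = \<bar>1 + b / a\<bar> * \<bar>a\<bar>" by (simp only: abs_mult)
        then show ?thesis by (simp only: powr_mult abs_ge_zero)
      qed
      then have "\<bar>a + b\<bar> powr p - \<bar>a\<bar> powr p = (\<bar>1 + b / a\<bar> powr p - 1) * \<bar>a\<bar> powr p"
        by (simp only: left_diff_distrib mult_1)
      then have "\<bar>\<bar>a + b\<bar> powr p - \<bar>a\<bar> powr p\<bar> = \<bar>\<bar>1 + b / a\<bar> powr p - 1\<bar> * \<bar>a\<bar> powr p"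
        by (simp only: abs_mult abs_of_nonneg powr_ge_zero)
      moreover have "1 * \<bar>b\<bar> powr p \<le> C * \<bar>b\<bar> powr p"
        by (intro mult_right_mono) (auto simp: C_def)
      moreover have "\<bar>x - w - z\<bar> \<le> E + F"
        if "\<bar>x - z\<bar> = y" "y \<le> E" "1 * w \<le> F" "w \<ge> 0" for x y z w E F :: real
        using that by linarith
      ultimately show ?thesis by (metis powr_ge_zero)
    next
      case False
      then have le: "\<bar>a\<bar> \<le> 1/\<delta> * \<bar>b\<bar>" using \<delta> by (simp add: field_simps)
      have "\<bar>a\<bar> powr p \<le> (1/\<delta> * \<bar>b\<bar>) powr p"
        using le p by (intro powr_mono2) auto
      also have "\<dots> = (1/\<delta>) powr p * \<bar>b\<bar> powr p" by (rule powr_mult)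
      finally have 1: "\<bar>a\<bar> powr p \<le> (1/\<delta>) powr p * \<bar>b\<bar> powr p" .
      have "\<bar>a + b\<bar> powr p \<le> ((1 + 1/\<delta>) * \<bar>b\<bar>) powr p"
        using le p \<delta> by (intro powr_mono2) (auto simp: distrib_right)
      also have "\<dots> = (1 + 1/\<delta>) powr p * \<bar>b\<bar> powr p" by (rule powr_mult)
      finally have 2: "\<bar>a + b\<bar> powr p \<le> (1 + 1/\<delta>) powr p * \<bar>b\<bar> powr p" .
      have "\<epsilon> * \<bar>a\<bar> powr p \<ge> 0" "\<bar>a\<bar> powr p \<ge> 0" "\<bar>b\<bar> powr p \<ge> 0" "\<bar>a + b\<bar> powr p \<ge> 0"
        using \<epsilon> by auto
      moreover have "C * \<bar>b\<bar> powr p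
          = (1 + 1/\<delta>) powr p * \<bar>b\<bar> powr p + (1/\<delta>) powr p * \<bar>b\<bar> powr p + \<bar>b\<bar> powr p"
        by (simp add: C_def distrib_right)
      moreover have "\<bar>x - w - z\<bar> \<le> E + F"
        if "E \<ge> 0" "z \<ge> 0" "w \<ge> 0" "x \<ge> 0" "F = F\<^sub>1 + F\<^sub>2 + w" "z \<le> F\<^sub>2" "x \<le> F\<^sub>1"
        for x z w E F F\<^sub>1 F\<^sub>2 :: real
        using that by linarith
      ultimately show ?thesis using 1 2 by metis
    qed
  qed
qed

lemma abs_diff_powr_le:
  fixes a b p :: real
  assumes "p \<ge> 0"
  shows "\<bar>a - b\<bar> powr p \<le> 2 powr p * (\<bar>a\<bar> powr p + \<bar>b\<bar> powr p)"
proof -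
  have "\<bar>a - b\<bar> powr p \<le> (2 * max \<bar>a\<bar> \<bar>b\<bar>) powr p"
    using assms by (intro powr_mono2) auto
  also have "\<dots> = 2 powr p * max \<bar>a\<bar> \<bar>b\<bar> powr p" by (simp add: powr_mult)
  also have "\<dots> \<le> 2 powr p * (\<bar>a\<bar> powr p + \<bar>b\<bar> powr p)"
    by (intro mult_left_mono) (auto simp: max_def)
  finally show ?thesis .
qed

text \<open>Uniform integrability: the part of \<open>\<bar>w n\<bar> powr p\<close> above a level \<open>L\<close> has integral at most
  \<open>L powr (p - q) * C\<close>, and the part below tends to zero by bounded convergence.\<close>

lemma nn_integral_powr_tendsto_0:
  fixes w :: "nat \<Rightarrow> 'a \<Rightarrow> real"
  assumes [measurable]: "\<And>n. w n \<in> borel_measurable M" "A \<in> sets M"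
    and A: "emeasure M A < \<infinity>" and p: "0 < p" "p < q"
    and lim: "AE x in M. (\<lambda>n. w n x) \<longlonglongrightarrow> 0"
    and bdd: "\<And>n. (\<integral>\<^sup>+x. ennreal (\<bar>w n x\<bar> powr q) * indicator A x \<partial>M) \<le> C" and C: "C < \<infinity>"
  shows "(\<lambda>n. \<integral>\<^sup>+x. ennreal (\<bar>w n x\<bar> powr p) * indicator A x \<partial>M) \<longlonglongrightarrow> 0"
proof (rule tendsto_0_ennreal_if_le_small_plus_null)
  fix r :: real assume r: "r > 0"
  obtain C' where C': "C = ennreal C'" "C' \<ge> 0" using C by (cases C) auto
  \<comment> \<open>Solves \<open>L powr (p - q) * (C' + 1) = r\<close>; the summand 1 covers \<open>C' = 0\<close>.\<close>
  define L where "L = (r / (C' + 1)) powr (1 / (p - q))"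
  have L: "L > 0" using r C' by (simp add: L_def)
  have "L powr (p - q) = r / (C' + 1)" using p r C' by (simp add: L_def powr_powr)
  then have "L powr (p - q) * C' \<le> r" using r C' by (simp add: divide_le_eq)
  then have L_le: "ennreal (L powr (p - q)) * C \<le> ennreal r"
    using C' by (simp add: ennreal_leI flip: ennreal_mult)
  define Y where "Y n = (\<integral>\<^sup>+x. ennreal (min (\<bar>w n x\<bar> powr p) (L powr p)) * indicator A x \<partial>M)" for n
  have "Y \<longlonglongrightarrow> (\<integral>\<^sup>+x. 0 \<partial>M)"
    unfolding Y_def
  proof (rule nn_integral_dominated_convergence[where w = "\<lambda>x. ennreal (L powr p) * indicator A x"])
    show "AE x in M. ennreal (min (\<bar>w j x\<bar> powr p) (L powr p)) * indicator A x
        \<le> ennreal (L powr p) * indicator A x" for j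
      by (intro AE_I2 mult_right_mono ennreal_leI) auto
    show "(\<integral>\<^sup>+x. ennreal (L powr p) * indicator A x \<partial>M) < \<infinity>"
      using A by (simp add: nn_integral_cmult_indicator ennreal_mult_less_top)
    show "AE x in M. (\<lambda>n. ennreal (min (\<bar>w n x\<bar> powr p) (L powr p)) * indicator A x) \<longlonglongrightarrow> 0"
      using lim
    proof eventually_elim
      case (elim x)
      have "(\<lambda>n. min (\<bar>w n x\<bar> powr p) (L powr p)) \<longlonglongrightarrow> min (\<bar>0\<bar> powr p) (L powr p)"
        by (intro tendsto_min tendsto_powr' tendsto_rabs elim tendsto_const) (use p in auto)
      then have "(\<lambda>n. ennreal (min (\<bar>w n x\<bar> powr p) (L powr p))) \<longlonglongrightarrow> ennreal 0"
        by (intro tendsto_ennrealI) simp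
      then show ?case by (auto simp: indicator_def)
    qed
  qed auto
  then have "Y \<longlonglongrightarrow> 0" by simp
  moreover have "(\<integral>\<^sup>+x. ennreal (\<bar>w n x\<bar> powr p) * indicator A x \<partial>M) \<le> ennreal r + Y n" for n
  proof -
    have pw: "t powr p \<le> L powr (p - q) * t powr q + min (t powr p) (L powr p)" if "t \<ge> 0" for t
    proof (cases "t \<le> L")
      case True
      then have "t powr p \<le> L powr p" using that p by (intro powr_mono2) auto
      then show ?thesis by (simp add: min_def)
    next
      case False
      then have "t powr p = t powr (p - q) * t powr q" using L by (simp flip: powr_add)
      also have "\<dots> \<le> L powr (p - q) * t powr q"
        using False L p by (intro mult_right_mono powr_mono2') auto
      finally show ?thesis using L by (simp add: add_increasing2)
    qed
    have "(\<integral>\<^sup>+x. ennreal (\<bar>w n x\<bar> powr p) * indicator A x \<partial>M)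
      \<le> (\<integral>\<^sup>+x. ennreal (L powr (p - q)) * (ennreal (\<bar>w n x\<bar> powr q) * indicator A x)
            + ennreal (min (\<bar>w n x\<bar> powr p) (L powr p)) * indicator A x \<partial>M)"
      using pw by (intro nn_integral_mono)
        (auto simp: indicator_def intro!: ennreal_leI simp flip: ennreal_mult ennreal_plus)
    also have "\<dots> = ennreal (L powr (p - q)) * (\<integral>\<^sup>+x. ennreal (\<bar>w n x\<bar> powr q) * indicator A x \<partial>M) + Y n"
      unfolding Y_def by (subst nn_integral_add) (auto simp: nn_integral_cmult)
    also have "\<dots> \<le> ennreal (L powr (p - q)) * C + Y n"
      by (intro add_right_mono mult_left_mono bdd) auto
    also have "\<dots> \<le> ennreal r + Y n" by (intro add_right_mono L_le)
    finally show ?thesis .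
  qed
  ultimately show "\<exists>Y. Y \<longlonglongrightarrow> 0 \<and>
      (\<forall>n. (\<integral>\<^sup>+x. ennreal (\<bar>w n x\<bar> powr p) * indicator A x \<partial>M) \<le> ennreal r + Y n)" by blast
qed

section \<open>Limits from a remainder and a weakly null part\<close>

lemma ennreal_power2_add_le:
  fixes x y :: ennreal
  shows "(x + y)\<^sup>2 \<le> 2 * x\<^sup>2 + 2 * y\<^sup>2"
proof -
  have "2 * x * y \<le> x\<^sup>2 + y\<^sup>2"
  proof (cases "x = top \<or> y = top")
    case False
    then obtain r s where [simp]: "x = ennreal r" "y = ennreal s" and rs: "r \<ge> 0" "s \<ge> 0"
      by (metis ennreal_cases)
    have "2 * r * s \<le> r\<^sup>2 + s\<^sup>2" by (rule sum_squares_bound)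
    then have "ennreal (2 * r * s) \<le> ennreal (r\<^sup>2 + s\<^sup>2)" by (rule ennreal_leI)
    then show ?thesis using rs by (simp add: ennreal_mult ennreal_power)
  qed (auto simp: power2_eq_square)
  then show ?thesis
    by (simp add: power2_sum mult_2 add_mono add_ac)
qed

lemma nn_integral_power2_add_le:
  assumes [measurable]: "f \<in> borel_measurable M" "g \<in> borel_measurable M"
  shows "(\<integral>\<^sup>+x. (f x + g x)\<^sup>2 \<partial>M) \<le> 2 * (\<integral>\<^sup>+x. (f x)\<^sup>2 \<partial>M) + 2 * (\<integral>\<^sup>+x. (g x)\<^sup>2 \<partial>M)"
proof -
  have "(\<integral>\<^sup>+x. (f x + g x)\<^sup>2 \<partial>M) \<le> (\<integral>\<^sup>+x. 2 * (f x)\<^sup>2 + 2 * (g x)\<^sup>2 \<partial>M)"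
    by (intro nn_integral_mono ennreal_power2_add_le)
  then show ?thesis by (simp add: nn_integral_add nn_integral_cmult)
qed

lemma abs_diff_enn2real_le:
  assumes "a \<le> c + d" "c \<le> a + d" "a \<noteq> top" "c \<noteq> top"
  shows "ennreal \<bar>enn2real a - enn2real c\<bar> \<le> d"
proof (cases "d = top")
  case False
  then obtain a' c' d' where [simp]: "a = ennreal a'" "c = ennreal c'" "d = ennreal d'"
      and "a' \<ge> 0" "c' \<ge> 0" "d' \<ge> 0"
    using assms by (metis ennreal_cases)
  then show ?thesis using assms by (auto simp flip: ennreal_plus intro!: ennreal_leI)
qed simp

lemma integrable_mult_if_power2:
  fixes f \<phi> :: "'a \<Rightarrow> real"
  assumes [measurable]: "f \<in> borel_measurable M" "\<phi> \<in> borel_measurable M"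
    and f: "(\<integral>\<^sup>+x. (ennreal \<bar>f x\<bar>)\<^sup>2 \<partial>M) < \<infinity>" and \<phi>: "(\<integral>\<^sup>+x. (ennreal \<bar>\<phi> x\<bar>)\<^sup>2 \<partial>M) < \<infinity>"
  shows "integrable M (\<lambda>x. f x * \<phi> x)"
proof (rule integrableI_bounded)
  define I where "I = (\<integral>\<^sup>+x. ennreal \<bar>f x\<bar> * ennreal \<bar>\<phi> x\<bar> \<partial>M)"
  have "I\<^sup>2 \<le> (\<integral>\<^sup>+x. (ennreal \<bar>f x\<bar>)\<^sup>2 \<partial>M) * (\<integral>\<^sup>+x. (ennreal \<bar>\<phi> x\<bar>)\<^sup>2 \<partial>M)"
    unfolding I_def by (rule Cauchy_Schwarz_nn_integral) auto
  also have "\<dots> < top" using f \<phi> by (simp add: ennreal_mult_less_top)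
  finally have "I < top" by (simp add: power_less_top_ennreal)
  then show "(\<integral>\<^sup>+x. norm (f x * \<phi> x) \<partial>M) < \<infinity>"
    by (simp add: I_def abs_mult ennreal_mult)
qed simp

text \<open>The difference of \<open>a n\<close> and \<open>c\<close> is at most \<open>b n + e n\<close>, where \<open>b n\<close> only tends to zero when
  tested against \<open>\<bar>\<phi>\<bar>\<close> and \<open>e n\<close> tends to zero in \<open>L\<^sup>2\<close>.\<close>

lemma weak_limit_if_remainders_null:
  fixes a b e :: "nat \<Rightarrow> 'a \<Rightarrow> ennreal" and c :: "'a \<Rightarrow> ennreal" and \<phi> :: "'a \<Rightarrow> real"
  assumes [measurable]: "\<And>n. a n \<in> borel_measurable M" "\<And>n. b n \<in> borel_measurable M"
      "\<And>n. e n \<in> borel_measurable M" "c \<in> borel_measurable M" "\<phi> \<in> borel_measurable M"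
    and le: "\<And>n x. a n x \<le> c x + b n x + e n x" "\<And>n x. c x + b n x \<le> a n x + e n x"
    and a: "\<And>n. (\<integral>\<^sup>+x. (a n x)\<^sup>2 \<partial>M) < \<infinity>" and c: "(\<integral>\<^sup>+x. (c x)\<^sup>2 \<partial>M) < \<infinity>"
    and \<phi>: "(\<integral>\<^sup>+x. (ennreal \<bar>\<phi> x\<bar>)\<^sup>2 \<partial>M) < \<infinity>"
    and b: "(\<lambda>n. \<integral>\<^sup>+x. ennreal \<bar>\<phi> x\<bar> * b n x \<partial>M) \<longlonglongrightarrow> 0"
    and e: "(\<lambda>n. \<integral>\<^sup>+x. (e n x)\<^sup>2 \<partial>M) \<longlonglongrightarrow> 0"
  shows "(\<lambda>n. \<integral>x. enn2real (a n x) * \<phi> x \<partial>M) \<longlonglongrightarrow> (\<integral>x. enn2real (c x) * \<phi> x \<partial>M)"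
proof -
  have fin: "AE x in M. f x \<noteq> top"
    and int: "integrable M (\<lambda>x. enn2real (f x) * \<phi> x)"
    if [measurable]: "f \<in> borel_measurable M" and f: "(\<integral>\<^sup>+x. (f x)\<^sup>2 \<partial>M) < \<infinity>" for f
  proof -
    have "AE x in M. (f x)\<^sup>2 \<noteq> \<infinity>" using f by (intro nn_integral_PInf_AE) auto
    then show fin: "AE x in M. f x \<noteq> top" by eventually_elim auto
    show "integrable M (\<lambda>x. enn2real (f x) * \<phi> x)"
    proof (rule integrable_mult_if_power2)
      have "(\<integral>\<^sup>+x. (ennreal \<bar>enn2real (f x)\<bar>)\<^sup>2 \<partial>M) = (\<integral>\<^sup>+x. (f x)\<^sup>2 \<partial>M)"
        using fin by (intro nn_integral_cong_AE) (auto simp: less_top)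
      then show "(\<integral>\<^sup>+x. (ennreal \<bar>enn2real (f x)\<bar>)\<^sup>2 \<partial>M) < \<infinity>" using f by simp
    qed (use \<phi> in auto)
  qed
  define d where "d n = (\<integral>x. enn2real (a n x) * \<phi> x \<partial>M) - (\<integral>x. enn2real (c x) * \<phi> x \<partial>M)" for n
  have bound: "ennreal \<bar>d n\<bar> \<le> (\<integral>\<^sup>+x. ennreal \<bar>\<phi> x\<bar> * b n x \<partial>M) + (\<integral>\<^sup>+x. e n x * ennreal \<bar>\<phi> x\<bar> \<partial>M)" for n
  proof -
    have "d n = (\<integral>x. (enn2real (a n x) - enn2real (c x)) * \<phi> x \<partial>M)"
      unfolding d_def using int[OF _ a] int[OF _ c] by (simp add: left_diff_distrib)
    also have "ennreal \<bar>\<dots>\<bar> \<le> (\<integral>\<^sup>+x. norm ((enn2real (a n x) - enn2real (c x)) * \<phi> x) \<partial>M)"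
    proof -
      have "integrable M (\<lambda>x. (enn2real (a n x) - enn2real (c x)) * \<phi> x)"
        using Bochner_Integration.integrable_diff[OF int[OF _ a] int[OF _ c]] by (simp add: left_diff_distrib)
      from integral_norm_bound_ennreal[OF this] show ?thesis by simp
    qed
    also have "\<dots> \<le> (\<integral>\<^sup>+x. ennreal \<bar>\<phi> x\<bar> * b n x + e n x * ennreal \<bar>\<phi> x\<bar> \<partial>M)"
    proof (rule nn_integral_mono_AE)
      have "AE x in M. a n x \<noteq> top" "AE x in M. c x \<noteq> top"
        using fin a c by auto
      then show "AE x in M. ennreal (norm ((enn2real (a n x) - enn2real (c x)) * \<phi> x))
          \<le> ennreal \<bar>\<phi> x\<bar> * b n x + e n x * ennreal \<bar>\<phi> x\<bar>"
      proof eventually_elim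
        case (elim x)
        have "c x \<le> c x + b n x" by simp
        also have "\<dots> \<le> a n x + e n x" by (rule le)
        also have "\<dots> \<le> a n x + (b n x + e n x)" by (intro add_left_mono) simp
        finally have "ennreal \<bar>enn2real (a n x) - enn2real (c x)\<bar> \<le> b n x + e n x"
          using le(1)[of n x] elim by (intro abs_diff_enn2real_le) (auto simp: add.assoc)
        from mult_right_mono[OF this, of "ennreal \<bar>\<phi> x\<bar>"] show ?case
          by (simp add: abs_mult ennreal_mult distrib_left distrib_right mult.commute)
      qed
    qed
    also have "\<dots> = (\<integral>\<^sup>+x. ennreal \<bar>\<phi> x\<bar> * b n x \<partial>M) + (\<integral>\<^sup>+x. e n x * ennreal \<bar>\<phi> x\<bar> \<partial>M)"
      by (subst nn_integral_add) auto
    finally show ?thesis .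
  qed
  have "(\<lambda>n. \<integral>\<^sup>+x. e n x * ennreal \<bar>\<phi> x\<bar> \<partial>M) \<longlonglongrightarrow> 0"
    by (rule nn_integral_mult_tendsto_0[where C = "\<integral>\<^sup>+x. (ennreal \<bar>\<phi> x\<bar>)\<^sup>2 \<partial>M"]) (use e \<phi> in auto)
  with b have lim: "(\<lambda>n. (\<integral>\<^sup>+x. ennreal \<bar>\<phi> x\<bar> * b n x \<partial>M) + (\<integral>\<^sup>+x. e n x * ennreal \<bar>\<phi> x\<bar> \<partial>M)) \<longlonglongrightarrow> 0"
    using tendsto_add by fastforce
  have "(\<lambda>n. ennreal \<bar>d n\<bar>) \<longlonglongrightarrow> 0"
    by (rule tendsto_sandwich[OF _ _ tendsto_const lim]) (auto intro!: always_eventually bound)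
  then have "(\<lambda>n. \<bar>d n\<bar>) \<longlonglongrightarrow> 0" by (subst (asm) ennreal_tendsto_0_iff) auto
  then have "d \<longlonglongrightarrow> 0" by (rule tendsto_rabs_zero_cancel)
  then show ?thesis unfolding d_def by (simp add: LIM_zero_iff)
qed

text \<open>If \<open>a - b\<close> is \<open>c\<close> up to an error \<open>e\<close>, then \<open>a\<^sup>2 - b\<^sup>2 = (a - b) (a + b)\<close> is \<open>c (2 b + c)\<close> up
  to terms that contain \<open>e\<close>. The mixed term \<open>2 c b\<close> counts as an error as well: it is small only
  after integration, when \<open>b\<close> is weakly null.\<close>

lemma absdiff_power2_near:
  fixes a b c e :: ennreal
  assumes le: "a \<le> c + b + e" "c + b \<le> a + e" and fin: "b \<noteq> top" "c \<noteq> top"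
  defines "G \<equiv> 2 * (e * b) + 2 * (e * c) + e\<^sup>2 + 2 * (c * b)"
  shows "ennreal_absdiff (a\<^sup>2) (b\<^sup>2) \<le> c\<^sup>2 + G" "c\<^sup>2 \<le> ennreal_absdiff (a\<^sup>2) (b\<^sup>2) + G"
proof -
  have "ennreal_absdiff (a\<^sup>2) (b\<^sup>2) \<le> c\<^sup>2 + G \<and> c\<^sup>2 \<le> ennreal_absdiff (a\<^sup>2) (b\<^sup>2) + G"
  proof (cases "e = top")
    case True
    then have "G = top" by (simp add: G_def power2_eq_square)
    then show ?thesis by simp
  next
    case False
    have "a \<noteq> top" using le(1) fin False by (auto simp: top_unique)
    then obtain a' b' c' e' where eqs: "a = ennreal a'" "b = ennreal b'" "c = ennreal c'" "e = ennreal e'"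
      and nn: "a' \<ge> 0" "b' \<ge> 0" "c' \<ge> 0" "e' \<ge> 0"
      using fin False by (metis ennreal_cases)
    have le': "a' \<le> c' + b' + e'" "c' + b' \<le> a' + e'"
      using le nn by (auto simp: eqs simp flip: ennreal_plus)
    define g where "g = 2 * (e' * b') + 2 * (e' * c') + e'\<^sup>2 + 2 * (c' * b')"
    have G: "G = ennreal g"
      using nn by (simp add: G_def g_def eqs ennreal_mult ennreal_power)
    have D: "ennreal_absdiff (a\<^sup>2) (b\<^sup>2) = ennreal \<bar>a'\<^sup>2 - b'\<^sup>2\<bar>"
    proof (cases "a'\<^sup>2 \<le> b'\<^sup>2")
      case True
      then show ?thesis using nn
        by (simp add: ennreal_absdiff_def eqs ennreal_power ennreal_minus ennreal_neg del: power2_le_iff_abs_le power_mono_iff)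
    next
      case False
      then show ?thesis using nn
        by (simp add: ennreal_absdiff_def eqs ennreal_power ennreal_minus ennreal_neg del: power2_le_iff_abs_le power_mono_iff)
    qed
    have "\<bar>a'\<^sup>2 - b'\<^sup>2\<bar> = \<bar>a' - b'\<bar> * (a' + b')"
      using nn by (simp add: power2_eq_square square_diff_square_factored abs_mult mult.commute)
    moreover have "\<bar>a' - b'\<bar> * (a' + b') \<le> (c' + e') * (c' + 2 * b' + e')"
      using nn le' by (intro mult_mono) auto
    moreover have "(c' + e') * (c' + 2 * b' + e') = c'\<^sup>2 + g"
      by (simp add: g_def power2_eq_square algebra_simps)
    ultimately have 1: "\<bar>a'\<^sup>2 - b'\<^sup>2\<bar> \<le> c'\<^sup>2 + g" by simp
    have 2: "c'\<^sup>2 \<le> \<bar>a'\<^sup>2 - b'\<^sup>2\<bar> + g"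
    \<comment> \<open>Squaring \<open>b' + (c' - e') \<le> a'\<close> requires the left-hand side to be nonnegative.\<close>
    proof (cases "c' \<le> e'")
      case True
      then have "c'\<^sup>2 \<le> e'\<^sup>2" using nn by (intro power_mono) auto
      then have "c'\<^sup>2 \<le> g" using nn by (simp add: g_def add_increasing add_increasing2)
      then show ?thesis by simp
    next
      case False
      then have "(b' + (c' - e'))\<^sup>2 \<le> a'\<^sup>2" using nn le' by (intro power_mono) auto
      then have "c'\<^sup>2 + 2 * (b' * (c' - e')) - 2 * (e' * c') + e'\<^sup>2 \<le> a'\<^sup>2 - b'\<^sup>2"
        by (simp add: power2_eq_square algebra_simps)
      moreover have "b' * (c' - e') \<ge> 0" "e'\<^sup>2 \<ge> 0" "e' * b' \<ge> 0" "c' * b' \<ge> 0"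
        using False nn by auto
      moreover have "a'\<^sup>2 - b'\<^sup>2 \<le> \<bar>a'\<^sup>2 - b'\<^sup>2\<bar>" by simp
      ultimately show ?thesis unfolding g_def by linarith
    qed
    have "g \<ge> 0" using nn by (simp add: g_def)
    then show ?thesis
      unfolding D G using 1 2 nn
      by (auto simp: eqs ennreal_power intro!: ennreal_leI simp flip: ennreal_plus)
  qed
  then show "ennreal_absdiff (a\<^sup>2) (b\<^sup>2) \<le> c\<^sup>2 + G" "c\<^sup>2 \<le> ennreal_absdiff (a\<^sup>2) (b\<^sup>2) + G" by auto
qed

lemma borel_measurable_ennreal_absdiff [measurable]:
  assumes [measurable]: "f \<in> borel_measurable M" "g \<in> borel_measurable M"
  shows "(\<lambda>x. ennreal_absdiff (f x) (g x)) \<in> borel_measurable M"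
  unfolding ennreal_absdiff_def by measurable

lemma nn_integral_absdiff_power2_tendsto:
  fixes a b e :: "nat \<Rightarrow> 'a \<Rightarrow> ennreal" and c :: "'a \<Rightarrow> ennreal"
  assumes [measurable]: "\<And>n. a n \<in> borel_measurable M" "\<And>n. b n \<in> borel_measurable M"
      "\<And>n. e n \<in> borel_measurable M" "c \<in> borel_measurable M"
    and le: "\<And>n x. a n x \<le> c x + b n x + e n x" "\<And>n x. c x + b n x \<le> a n x + e n x"
    and b: "\<And>n. (\<integral>\<^sup>+x. (b n x)\<^sup>2 \<partial>M) \<le> C" "C < \<infinity>" and c: "(\<integral>\<^sup>+x. (c x)\<^sup>2 \<partial>M) < \<infinity>"
    and e: "(\<lambda>n. \<integral>\<^sup>+x. (e n x)\<^sup>2 \<partial>M) \<longlonglongrightarrow> 0"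
    and cb: "(\<lambda>n. \<integral>\<^sup>+x. c x * b n x \<partial>M) \<longlonglongrightarrow> 0"
  shows "(\<lambda>n. \<integral>\<^sup>+x. ennreal_absdiff ((a n x)\<^sup>2) ((b n x)\<^sup>2) \<partial>M) \<longlonglongrightarrow> (\<integral>\<^sup>+x. (c x)\<^sup>2 \<partial>M)"
proof -
  define D where "D n = (\<integral>\<^sup>+x. ennreal_absdiff ((a n x)\<^sup>2) ((b n x)\<^sup>2) \<partial>M)" for n
  define G where "G n x = 2 * (e n x * b n x) + 2 * (e n x * c x) + (e n x)\<^sup>2 + 2 * (c x * b n x)" for n x
  define J where "J = (\<integral>\<^sup>+x. (c x)\<^sup>2 \<partial>M)"
  have [measurable]: "G n \<in> borel_measurable M" for n unfolding G_def by measurable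
  have "(\<lambda>n. 2 * (\<integral>\<^sup>+x. e n x * b n x \<partial>M) + 2 * (\<integral>\<^sup>+x. e n x * c x \<partial>M)
      + (\<integral>\<^sup>+x. (e n x)\<^sup>2 \<partial>M) + 2 * (\<integral>\<^sup>+x. c x * b n x \<partial>M)) \<longlonglongrightarrow> 2 * 0 + 2 * 0 + 0 + 2 * 0"
    by (intro tendsto_add ennreal_tendsto_cmult e cb nn_integral_mult_tendsto_0[OF _ _ e b]
          nn_integral_mult_tendsto_0[OF _ _ e order_refl c]) auto
  moreover have "(\<integral>\<^sup>+x. G n x \<partial>M) = 2 * (\<integral>\<^sup>+x. e n x * b n x \<partial>M) + 2 * (\<integral>\<^sup>+x. e n x * c x \<partial>M)
      + (\<integral>\<^sup>+x. (e n x)\<^sup>2 \<partial>M) + 2 * (\<integral>\<^sup>+x. c x * b n x \<partial>M)" for n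
    unfolding G_def by (simp add: nn_integral_add nn_integral_cmult)
  ultimately have G0: "(\<lambda>n. \<integral>\<^sup>+x. G n x \<partial>M) \<longlonglongrightarrow> 0" by simp
  have near: "AE x in M. ennreal_absdiff ((a n x)\<^sup>2) ((b n x)\<^sup>2) \<le> (c x)\<^sup>2 + G n x \<and>
      (c x)\<^sup>2 \<le> ennreal_absdiff ((a n x)\<^sup>2) ((b n x)\<^sup>2) + G n x" for n
  proof -
    have "(\<integral>\<^sup>+x. (b n x)\<^sup>2 \<partial>M) < \<infinity>" using b le_less_trans by blast
    then have "AE x in M. (b n x)\<^sup>2 \<noteq> \<infinity>" "AE x in M. (c x)\<^sup>2 \<noteq> \<infinity>"
      using c by (intro nn_integral_PInf_AE; simp)+
    then show ?thesis
    proof eventually_elim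
      case (elim x)
      then have "b n x \<noteq> top" "c x \<noteq> top" by auto
      then show ?case unfolding G_def using absdiff_power2_near[OF le(1)[of n x] le(2)[of x n]] by simp
    qed
  qed
  have upper: "D n \<le> J + (\<integral>\<^sup>+x. G n x \<partial>M)" for n
  proof -
    have "D n \<le> (\<integral>\<^sup>+x. (c x)\<^sup>2 + G n x \<partial>M)"
      unfolding D_def using near[of n] by (intro nn_integral_mono_AE) auto
    then show ?thesis by (simp add: J_def nn_integral_add)
  qed
  have "J \<le> (\<integral>\<^sup>+x. ennreal_absdiff ((a n x)\<^sup>2) ((b n x)\<^sup>2) + G n x \<partial>M)" for n
    unfolding J_def using near[of n] by (intro nn_integral_mono_AE) auto
  then have lower: "J - (\<integral>\<^sup>+x. G n x \<partial>M) \<le> D n" for n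
    using c by (auto simp: D_def J_def nn_integral_add ennreal_minus_le_iff add.commute)
  have "(\<lambda>n. J + (\<integral>\<^sup>+x. G n x \<partial>M)) \<longlonglongrightarrow> J + 0"
    by (intro tendsto_add tendsto_const G0)
  moreover have "(\<lambda>n. J - (\<integral>\<^sup>+x. G n x \<partial>M)) \<longlonglongrightarrow> J - 0"
    by (intro tendsto_diff_ennreal tendsto_const G0) (use c in \<open>auto simp: J_def\<close>)
  ultimately have "D \<longlonglongrightarrow> J"
    by (intro tendsto_sandwich[of "\<lambda>n. J - (\<integral>\<^sup>+x. G n x \<partial>M)" D sequentially "\<lambda>n. J + (\<integral>\<^sup>+x. G n x \<partial>M)"])
       (auto intro!: always_eventually upper lower)
  then show ?thesis by (simp add: D_def[abs_def] J_def)
qed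

section \<open>The two limits for Riesz potentials of powers\<close>

text \<open>Boundedness in a local \<open>L\<^sup>q\<close> space with \<open>q > p\<close> prevents \<open>\<bar>w n\<bar> powr p\<close> from concentrating, so
  that it tends to zero in the local \<open>L\<^sup>1\<close> sense; its potential then does the same, and a bounded
  sequence in \<open>L\<^sup>2\<close> that tends to zero locally in \<open>L\<^sup>1\<close> tends to zero weakly.\<close>

lemma riesz_potential_powr_weakly_null:
  fixes w :: "nat \<Rightarrow> 'a::euclidean_space \<Rightarrow> real"
  assumes \<beta>: "0 < \<beta>" "\<beta> < real DIM('a)" and p: "0 < p" "p < q"
    and w [measurable]: "\<And>n. w n \<in> borel_measurable borel"
    and lim: "AE x in lborel. (\<lambda>n. w n x) \<longlonglongrightarrow> 0"
    and bdd: "\<And>n. (\<integral>\<^sup>+x. (riesz_potential \<beta> (\<lambda>y. ennreal (\<bar>w n y\<bar> powr p)) x)\<^sup>2 \<partial>lborel) \<le> C"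
    and C: "C < \<infinity>"
    and loc: "\<And>M. \<exists>C'<\<infinity>. \<forall>n. (\<integral>\<^sup>+x. ennreal (\<bar>w n x\<bar> powr q) * indicator (ball 0 M) x \<partial>lborel) \<le> C'"
    and \<phi> [measurable]: "\<phi> \<in> borel_measurable lebesgue" and \<phi>2: "(\<integral>\<^sup>+x. (\<phi> x)\<^sup>2 \<partial>lebesgue) < \<infinity>"
  shows "(\<lambda>n. \<integral>\<^sup>+x. \<phi> x * riesz_potential \<beta> (\<lambda>y. ennreal (\<bar>w n y\<bar> powr p)) x \<partial>lebesgue) \<longlonglongrightarrow> 0"
proof (rule weakly_null_if_locally_null[where A = "\<lambda>m. ball 0 (real (Suc m))" and C = C])
  show "riesz_potential \<beta> (\<lambda>y. ennreal (\<bar>w n y\<bar> powr p)) \<in> borel_measurable lebesgue" for n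
    by (rule measurable_completion) measurable
  show "(\<integral>\<^sup>+x. (riesz_potential \<beta> (\<lambda>y. ennreal (\<bar>w n y\<bar> powr p)) x)\<^sup>2 \<partial>lebesgue) \<le> C" for n
    using bdd[of n] by (simp add: nn_integral_completion)
  show "eventually (\<lambda>m. x \<in> ball 0 (real (Suc m))) sequentially" for x :: 'a
  proof -
    obtain k :: nat where k: "norm x < real k" using reals_Archimedean2 by blast
    show ?thesis using eventually_ge_at_top[of k]
      by eventually_elim (use k in \<open>auto simp: dist_norm\<close>)
  qed
  have "(\<lambda>n. \<integral>\<^sup>+x. ennreal (\<bar>w n x\<bar> powr p) * indicator (ball 0 M) x \<partial>lborel) \<longlonglongrightarrow> 0" for M
  proof -
    obtain C' where "C' < \<infinity>"
      "\<And>n. (\<integral>\<^sup>+x. ennreal (\<bar>w n x\<bar> powr q) * indicator (ball 0 M) x \<partial>lborel) \<le> C'"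
      using loc by blast
    then show ?thesis
      by (intro nn_integral_powr_tendsto_0[where q = q and C = C'] p lim)
         (auto simp: emeasure_bounded_finite simp flip: infinity_ennreal_def)
  qed
  then show "(\<lambda>n. \<integral>\<^sup>+x. riesz_potential \<beta> (\<lambda>y. ennreal (\<bar>w n y\<bar> powr p)) x
      * indicator (ball 0 (real (Suc m))) x \<partial>lebesgue) \<longlonglongrightarrow> 0" for m
    unfolding nn_integral_completion
    by (intro riesz_potential_locally_null[OF \<beta> _ bdd C]) auto
qed (use \<phi>2 C in auto)

text \<open>The defect is at most \<open>\<epsilon> * \<bar>w n\<bar> powr p\<close> plus a term that is dominated by a multiple of
  \<open>\<bar>v\<bar> powr p\<close> and tends to zero almost everywhere. Dominated convergence, first in the
  convolution and then in \<open>L\<^sup>2\<close>, disposes of the latter.\<close>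

lemma riesz_potential_powr_defect_tendsto_0:
  fixes w :: "nat \<Rightarrow> 'a::euclidean_space \<Rightarrow> real"
  assumes p: "0 < p"
    and w [measurable]: "\<And>n. w n \<in> borel_measurable borel" and [measurable]: "v \<in> borel_measurable borel"
    and lim: "AE x in lborel. (\<lambda>n. w n x) \<longlonglongrightarrow> 0"
    and bdd: "\<And>n. (\<integral>\<^sup>+x. (riesz_potential \<beta> (\<lambda>y. ennreal (\<bar>w n y\<bar> powr p)) x)\<^sup>2 \<partial>lborel) \<le> C"
    and C: "C < \<infinity>"
    and v: "(\<integral>\<^sup>+x. (riesz_potential \<beta> (\<lambda>y. ennreal (\<bar>v y\<bar> powr p)) x)\<^sup>2 \<partial>lborel) < \<infinity>"
  shows "(\<lambda>n. \<integral>\<^sup>+x. (riesz_potential \<beta>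
      (\<lambda>y. ennreal \<bar>\<bar>w n y + v y\<bar> powr p - \<bar>v y\<bar> powr p - \<bar>w n y\<bar> powr p\<bar>) x)\<^sup>2 \<partial>lborel) \<longlonglongrightarrow> 0"
proof (rule tendsto_0_ennreal_if_le_small_plus_null)
  fix r :: real assume r: "r > 0"
  define def where "def n y = \<bar>\<bar>w n y + v y\<bar> powr p - \<bar>v y\<bar> powr p - \<bar>w n y\<bar> powr p\<bar>" for n y
  define g where "g n y = ennreal (\<bar>w n y\<bar> powr p)" for n y
  have [measurable]: "def n \<in> borel_measurable borel" "g n \<in> borel_measurable borel" for n
    unfolding def_def g_def by measurable
  obtain C' where C': "C = ennreal C'" "C' \<ge> 0" using C by (cases C) auto
  \<comment> \<open>Chosen so that \<open>2 * \<epsilon>\<^sup>2 * C'\<close>, the bound for the part proportional to \<open>\<bar>w n\<bar> powr p\<close>, is at most \<open>r\<close>.\<close>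
  define \<epsilon> where "\<epsilon> = sqrt (r / (2 * (C' + 1)))"
  have \<epsilon>: "\<epsilon> > 0" using r C' by (simp add: \<epsilon>_def)
  have "2 * \<epsilon>\<^sup>2 * C' \<le> r" using r C' by (simp add: \<epsilon>_def divide_le_eq)
  then have \<epsilon>_le: "2 * ((ennreal \<epsilon>)\<^sup>2 * C) \<le> ennreal r"
    using C' \<epsilon> by (simp add: ennreal_power ennreal_leI mult.assoc flip: ennreal_mult ennreal_numeral)
  obtain K where K: "K \<ge> 0" and K_le:
    "\<And>a b::real. \<bar>\<bar>a + b\<bar> powr p - \<bar>b\<bar> powr p - \<bar>a\<bar> powr p\<bar> \<le> \<epsilon> * \<bar>a\<bar> powr p + K * \<bar>b\<bar> powr p"
    using powr_add_defect_le[OF p \<epsilon>] by blast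
  define h where "h n y = ennreal (min (def n y) (K * \<bar>v y\<bar> powr p))" for n y
  have [measurable]: "h n \<in> borel_measurable borel" for n unfolding h_def by measurable
  define Y where "Y n = 2 * (\<integral>\<^sup>+x. (riesz_potential \<beta> (h n) x)\<^sup>2 \<partial>lborel)" for n
  have "(\<lambda>n. \<integral>\<^sup>+x. (riesz_potential \<beta> (h n) x)\<^sup>2 \<partial>lborel) \<longlonglongrightarrow> 0"
  proof (rule riesz_potential_dominated_convergence
      [where F = "\<lambda>y. ennreal K * ennreal (\<bar>v y\<bar> powr p)"])
    show "h n y \<le> ennreal K * ennreal (\<bar>v y\<bar> powr p)" for n y
      using K by (simp add: h_def ennreal_leI flip: ennreal_mult)
    show "AE y in lborel. (\<lambda>n. h n y) \<longlonglongrightarrow> 0"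
      using lim
    proof eventually_elim
      case (elim y)
      have "(\<lambda>n. min (def n y) (K * \<bar>v y\<bar> powr p))
          \<longlonglongrightarrow> min \<bar>\<bar>0 + v y\<bar> powr p - \<bar>v y\<bar> powr p - \<bar>0\<bar> powr p\<bar> (K * \<bar>v y\<bar> powr p)"
        unfolding def_def using p
        by (intro tendsto_min tendsto_rabs tendsto_diff tendsto_powr' tendsto_add elim tendsto_const) auto
      also have "min \<bar>\<bar>0 + v y\<bar> powr p - \<bar>v y\<bar> powr p - \<bar>0\<bar> powr p\<bar> (K * \<bar>v y\<bar> powr p) = 0"
        using K by simp
      finally show ?case unfolding h_def using tendsto_ennrealI by force
    qed
    have "(\<integral>\<^sup>+x. (riesz_potential \<beta> (\<lambda>y. ennreal K * ennreal (\<bar>v y\<bar> powr p)) x)\<^sup>2 \<partial>lborel)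
      = (ennreal K)\<^sup>2 * (\<integral>\<^sup>+x. (riesz_potential \<beta> (\<lambda>y. ennreal (\<bar>v y\<bar> powr p)) x)\<^sup>2 \<partial>lborel)"
      by (subst riesz_potential_cmult, measurable, simp add: power_mult_distrib nn_integral_cmult)
    then show "(\<integral>\<^sup>+x. (riesz_potential \<beta> (\<lambda>y. ennreal K * ennreal (\<bar>v y\<bar> powr p)) x)\<^sup>2 \<partial>lborel) < \<infinity>"
      using v K by (simp add: ennreal_mult_less_top ennreal_power)
  qed auto
  then have "Y \<longlonglongrightarrow> 0" unfolding Y_def using ennreal_tendsto_cmult[of 2] by fastforce
  moreover have "(\<integral>\<^sup>+x. (riesz_potential \<beta> (\<lambda>y. ennreal (def n y)) x)\<^sup>2 \<partial>lborel) \<le> ennreal r + Y n" for n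
  proof -
    have pw: "ennreal (def n y) \<le> ennreal \<epsilon> * g n y + h n y" for y
    proof -
      have "def n y \<le> \<epsilon> * \<bar>w n y\<bar> powr p + min (def n y) (K * \<bar>v y\<bar> powr p)"
        using K_le[of "w n y" "v y"] \<epsilon> by (auto simp: def_def min_def)
      moreover have "min (def n y) (K * \<bar>v y\<bar> powr p) \<ge> 0" using K by (simp add: def_def)
      ultimately show ?thesis
        using \<epsilon> by (simp add: g_def h_def ennreal_leI flip: ennreal_mult ennreal_plus)
    qed
    have "riesz_potential \<beta> (\<lambda>y. ennreal (def n y)) x
        \<le> ennreal \<epsilon> * riesz_potential \<beta> (g n) x + riesz_potential \<beta> (h n) x" for x
    proof -
      have "riesz_potential \<beta> (\<lambda>y. ennreal (def n y)) x
          \<le> riesz_potential \<beta> (\<lambda>y. ennreal \<epsilon> * g n y + h n y) x"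
        by (rule riesz_potential_mono) (rule pw)
      then show ?thesis by (simp add: riesz_potential_add riesz_potential_cmult)
    qed
    then have "(\<integral>\<^sup>+x. (riesz_potential \<beta> (\<lambda>y. ennreal (def n y)) x)\<^sup>2 \<partial>lborel)
      \<le> (\<integral>\<^sup>+x. (ennreal \<epsilon> * riesz_potential \<beta> (g n) x + riesz_potential \<beta> (h n) x)\<^sup>2 \<partial>lborel)"
      by (intro nn_integral_mono power_mono) auto
    also have "\<dots> \<le> 2 * (\<integral>\<^sup>+x. (ennreal \<epsilon> * riesz_potential \<beta> (g n) x)\<^sup>2 \<partial>lborel) + Y n"
      unfolding Y_def by (rule nn_integral_power2_add_le) auto
    also have "\<dots> = 2 * ((ennreal \<epsilon>)\<^sup>2 * (\<integral>\<^sup>+x. (riesz_potential \<beta> (g n) x)\<^sup>2 \<partial>lborel)) + Y n"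
      by (simp add: power_mult_distrib nn_integral_cmult)
    also have "\<dots> \<le> 2 * ((ennreal \<epsilon>)\<^sup>2 * C) + Y n"
      using bdd[of n] by (intro add_right_mono mult_left_mono) (auto simp: g_def[abs_def])
    also have "\<dots> \<le> ennreal r + Y n" by (intro add_right_mono \<epsilon>_le)
    finally show ?thesis .
  qed
  ultimately show "\<exists>Y. Y \<longlonglongrightarrow> 0 \<and> (\<forall>n. (\<integral>\<^sup>+x. (riesz_potential \<beta>
      (\<lambda>y. ennreal \<bar>\<bar>w n y + v y\<bar> powr p - \<bar>v y\<bar> powr p - \<bar>w n y\<bar> powr p\<bar>) x)\<^sup>2 \<partial>lborel)
      \<le> ennreal r + Y n)"
    unfolding def_def by blast
qed

text \<open>The bound for \<open>u n\<close> passes to the limit \<open>v\<close> by Fatou's lemma.\<close>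

lemma nn_integral_diff_powr_bounded:
  fixes u :: "nat \<Rightarrow> 'a::euclidean_space \<Rightarrow> real"
  assumes q: "0 < q"
    and [measurable]: "\<And>n. u n \<in> borel_measurable borel" "v \<in> borel_measurable borel" "A \<in> sets borel"
    and lim: "AE x in lborel. (\<lambda>n. u n x) \<longlonglongrightarrow> v x"
    and bdd: "\<And>n. (\<integral>\<^sup>+x. ennreal (\<bar>u n x\<bar> powr q) * indicator A x \<partial>lborel) \<le> C"
  shows "(\<integral>\<^sup>+x. ennreal (\<bar>u n x - v x\<bar> powr q) * indicator A x \<partial>lborel) \<le> ennreal (2 powr q) * (C + C)"
proof -
  have v: "(\<integral>\<^sup>+x. ennreal (\<bar>v x\<bar> powr q) * indicator A x \<partial>lborel) \<le> C"
  proof -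
    have "(\<integral>\<^sup>+x. ennreal (\<bar>v x\<bar> powr q) * indicator A x \<partial>lborel)
        = (\<integral>\<^sup>+x. liminf (\<lambda>n. ennreal (\<bar>u n x\<bar> powr q) * indicator A x) \<partial>lborel)"
    proof (rule nn_integral_cong_AE)
      show "AE x in lborel. ennreal (\<bar>v x\<bar> powr q) * indicator A x
          = liminf (\<lambda>n. ennreal (\<bar>u n x\<bar> powr q) * indicator A x)"
        using lim
      proof eventually_elim
        case (elim x)
        have "(\<lambda>n. ennreal (\<bar>u n x\<bar> powr q)) \<longlonglongrightarrow> ennreal (\<bar>v x\<bar> powr q)"
          using q by (intro tendsto_ennrealI tendsto_powr' tendsto_rabs elim tendsto_const) auto
        then have "liminf (\<lambda>n. ennreal (\<bar>u n x\<bar> powr q)) = ennreal (\<bar>v x\<bar> powr q)"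
          by (rule lim_imp_Liminf[rotated]) simp
        then show ?case by (auto simp: indicator_def Liminf_const)
      qed
    qed
    also have "\<dots> \<le> liminf (\<lambda>n. \<integral>\<^sup>+x. ennreal (\<bar>u n x\<bar> powr q) * indicator A x \<partial>lborel)"
      by (rule nn_integral_liminf) auto
    also have "\<dots> \<le> C" by (rule Liminf_le) (use bdd in auto)
    finally show ?thesis .
  qed
  have "(\<integral>\<^sup>+x. ennreal (\<bar>u n x - v x\<bar> powr q) * indicator A x \<partial>lborel)
    \<le> (\<integral>\<^sup>+x. ennreal (2 powr q) * (ennreal (\<bar>u n x\<bar> powr q) * indicator A x
          + ennreal (\<bar>v x\<bar> powr q) * indicator A x) \<partial>lborel)"
    using abs_diff_powr_le[of q] q
    by (intro nn_integral_mono) (auto simp: indicator_def intro!: ennreal_leI simp flip: ennreal_mult ennreal_plus)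
  also have "\<dots> = ennreal (2 powr q) * ((\<integral>\<^sup>+x. ennreal (\<bar>u n x\<bar> powr q) * indicator A x \<partial>lborel)
      + (\<integral>\<^sup>+x. ennreal (\<bar>v x\<bar> powr q) * indicator A x \<partial>lborel))"
    by (simp add: nn_integral_cmult nn_integral_add)
  also have "\<dots> \<le> ennreal (2 powr q) * (C + C)"
    by (intro mult_left_mono add_mono bdd v) auto
  finally show ?thesis .
qed

lemma nn_integral_riesz_potential_diff_powr_bounded:
  fixes u :: "'a::euclidean_space \<Rightarrow> real"
  assumes p: "0 < p"
    and [measurable]: "u \<in> borel_measurable borel" "v \<in> borel_measurable borel"
    and u: "(\<integral>\<^sup>+x. (riesz_potential \<beta> (\<lambda>y. ennreal (\<bar>u y\<bar> powr p)) x)\<^sup>2 \<partial>lborel) \<le> C"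
    and v: "(\<integral>\<^sup>+x. (riesz_potential \<beta> (\<lambda>y. ennreal (\<bar>v y\<bar> powr p)) x)\<^sup>2 \<partial>lborel) \<le> C"
  shows "(\<integral>\<^sup>+x. (riesz_potential \<beta> (\<lambda>y. ennreal (\<bar>u y - v y\<bar> powr p)) x)\<^sup>2 \<partial>lborel)
      \<le> (ennreal (2 powr p))\<^sup>2 * (2 * C + 2 * C)"
proof -
  have "riesz_potential \<beta> (\<lambda>y. ennreal (\<bar>u y - v y\<bar> powr p)) x
      \<le> ennreal (2 powr p) * (riesz_potential \<beta> (\<lambda>y. ennreal (\<bar>u y\<bar> powr p)) x
          + riesz_potential \<beta> (\<lambda>y. ennreal (\<bar>v y\<bar> powr p)) x)" for x
  proof -
    have "riesz_potential \<beta> (\<lambda>y. ennreal (\<bar>u y - v y\<bar> powr p)) x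
      \<le> riesz_potential \<beta> (\<lambda>y. ennreal (2 powr p) * (ennreal (\<bar>u y\<bar> powr p) + ennreal (\<bar>v y\<bar> powr p))) x"
      using abs_diff_powr_le[of p] p
      by (intro riesz_potential_mono) (auto intro!: ennreal_leI simp flip: ennreal_mult ennreal_plus)
    then show ?thesis by (simp add: riesz_potential_cmult riesz_potential_add)
  qed
  then have "(\<integral>\<^sup>+x. (riesz_potential \<beta> (\<lambda>y. ennreal (\<bar>u y - v y\<bar> powr p)) x)\<^sup>2 \<partial>lborel)
    \<le> (\<integral>\<^sup>+x. (ennreal (2 powr p) * (riesz_potential \<beta> (\<lambda>y. ennreal (\<bar>u y\<bar> powr p)) x
          + riesz_potential \<beta> (\<lambda>y. ennreal (\<bar>v y\<bar> powr p)) x))\<^sup>2 \<partial>lborel)"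
    by (intro nn_integral_mono power_mono) auto
  also have "\<dots> = (ennreal (2 powr p))\<^sup>2 * (\<integral>\<^sup>+x. (riesz_potential \<beta> (\<lambda>y. ennreal (\<bar>u y\<bar> powr p)) x
          + riesz_potential \<beta> (\<lambda>y. ennreal (\<bar>v y\<bar> powr p)) x)\<^sup>2 \<partial>lborel)"
    by (simp add: power_mult_distrib nn_integral_cmult)
  also have "\<dots> \<le> (ennreal (2 powr p))\<^sup>2 * (2 * C + 2 * C)"
    by (intro mult_left_mono order_trans[OF nn_integral_power2_add_le] add_mono u v) auto
  finally show ?thesis .
qed

lemma nonneg_conv_eq_riesz_potential:
  assumes "AE y in lborel. f y = f' y"
  shows "nonneg_conv (riesz_kernel \<beta>) f = riesz_potential \<beta> (\<lambda>y. ennreal (f' y))"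
  unfolding nonneg_conv_def riesz_potential_def nn_integral_completion
  using assms by (intro ext nn_integral_cong_AE) auto

theorem proposition4p7:
  fixes u :: "nat \<Rightarrow> real ^ 'n \<Rightarrow> real"
    and v :: "real ^ 'n \<Rightarrow> real"
    and \<alpha> p :: real
  assumes "0 < \<alpha>" and "\<alpha> < real CARD('n)"
    and "p \<ge> 1"
    and "\<And>n. u n \<in> borel_measurable lebesgue"
    and "AE x in lebesgue. (\<lambda>n. u n x) \<longlonglongrightarrow> v x"
    and "bounded_in_L2 (\<lambda>n. nonneg_conv (riesz_kernel (\<alpha> / 2)) (\<lambda>y. \<bar>u n y\<bar> powr p))"
    and "\<exists>q>p. bounded_in_Lq_loc q u"
  shows "weakly_converges_L2
           (\<lambda>n. nonneg_conv (riesz_kernel (\<alpha> / 2)) (\<lambda>y. \<bar>u n y\<bar> powr p))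
           (nonneg_conv (riesz_kernel (\<alpha> / 2)) (\<lambda>y. \<bar>v y\<bar> powr p)) \<and>
         (\<lambda>n. \<integral>\<^sup>+ x. ennreal_absdiff
             ((nonneg_conv (riesz_kernel (\<alpha> / 2)) (\<lambda>y. \<bar>u n y\<bar> powr p) x)\<^sup>2)
             ((nonneg_conv (riesz_kernel (\<alpha> / 2)) (\<lambda>y. \<bar>u n y - v y\<bar> powr p) x)\<^sup>2)
             \<partial>lebesgue)
           \<longlonglongrightarrow> (\<integral>\<^sup>+ x. (nonneg_conv (riesz_kernel (\<alpha> / 2)) (\<lambda>y. \<bar>v y\<bar> powr p) x)\<^sup>2
               \<partial>lebesgue)"
proof -
  define \<beta> where "\<beta> = \<alpha> / 2"
  have \<beta>: "0 < \<beta>" "\<beta> < real DIM(real ^ 'n)" using assms(1,2) by (auto simp: \<beta>_def)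
  have p: "p > 0" using assms(3) by simp
  obtain q where q: "q > p" and Lq: "bounded_in_Lq_loc q u" using assms(7) by blast

  \<comment> \<open>Borel representatives: neither the potentials nor the local bounds see the null sets.\<close>
  obtain U where U [measurable]: "\<And>n. U n \<in> borel_measurable borel"
    and uU: "\<And>n. AE x in lborel. u n x = U n x"
    using completion_ex_borel_measurable_real[OF assms(4)] by (metis measurable_lborel2)
  define V where "V x = lim (\<lambda>n. U n x)" for x
  have [measurable]: "V \<in> borel_measurable borel" unfolding V_def by measurable
  have uU_all: "AE x in lborel. \<forall>n. u n x = U n x" using uU by (simp add: AE_all_countable)
  have limv: "AE x in lborel. (\<lambda>n. u n x) \<longlonglongrightarrow> v x" using assms(5) by (simp add: AE_completion_iff)
  have vV: "AE x in lborel. v x = V x"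
    using uU_all limv by eventually_elim (simp add: V_def limI)
  have limV: "AE x in lborel. (\<lambda>n. U n x) \<longlonglongrightarrow> V x"
    using uU_all limv vV by eventually_elim simp

  define a where "a n = riesz_potential \<beta> (\<lambda>y. ennreal (\<bar>U n y\<bar> powr p))" for n
  define b where "b n = riesz_potential \<beta> (\<lambda>y. ennreal (\<bar>U n y - V y\<bar> powr p))" for n
  define c where "c = riesz_potential \<beta> (\<lambda>y. ennreal (\<bar>V y\<bar> powr p))"
  define e where "e n = riesz_potential \<beta> (\<lambda>y. ennreal
      \<bar>\<bar>(U n y - V y) + V y\<bar> powr p - \<bar>V y\<bar> powr p - \<bar>U n y - V y\<bar> powr p\<bar>)" for n
  have a_eq: "nonneg_conv (riesz_kernel (\<alpha> / 2)) (\<lambda>y. \<bar>u n y\<bar> powr p) = a n" for n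
    unfolding a_def \<beta>_def[symmetric] using uU[of n]
    by (intro nonneg_conv_eq_riesz_potential) auto
  have b_eq: "nonneg_conv (riesz_kernel (\<alpha> / 2)) (\<lambda>y. \<bar>u n y - v y\<bar> powr p) = b n" for n
    unfolding b_def \<beta>_def[symmetric] using uU[of n] vV
    by (intro nonneg_conv_eq_riesz_potential) auto
  have c_eq: "nonneg_conv (riesz_kernel (\<alpha> / 2)) (\<lambda>y. \<bar>v y\<bar> powr p) = c"
    unfolding c_def \<beta>_def[symmetric] using vV
    by (intro nonneg_conv_eq_riesz_potential) auto
  have "a n \<in> borel_measurable borel" "b n \<in> borel_measurable borel" "c \<in> borel_measurable borel"
    "e n \<in> borel_measurable borel" for n
    unfolding a_def b_def c_def e_def by measurable
  then have meas [measurable]: "a n \<in> borel_measurable lebesgue" "b n \<in> borel_measurable lebesgue"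
    "c \<in> borel_measurable lebesgue" "e n \<in> borel_measurable lebesgue" for n
    by (auto intro!: measurable_completion)

  \<comment> \<open>Before the potential is applied, \<open>\<bar>U n\<bar>\<^sup>p\<close> and \<open>\<bar>V\<bar>\<^sup>p + \<bar>U n - V\<bar>\<^sup>p\<close> differ by the density of \<open>e n\<close>.\<close>
  have a_le: "a n x \<le> c x + b n x + e n x" for n x
  proof -
    have "a n x \<le> riesz_potential \<beta> (\<lambda>y. ennreal (\<bar>V y\<bar> powr p) + ennreal (\<bar>U n y - V y\<bar> powr p)
      + ennreal \<bar>\<bar>(U n y - V y) + V y\<bar> powr p - \<bar>V y\<bar> powr p - \<bar>U n y - V y\<bar> powr p\<bar>) x"
      unfolding a_def by (intro riesz_potential_mono) (auto intro!: ennreal_leI simp flip: ennreal_plus)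
    then show ?thesis by (simp add: riesz_potential_add b_def c_def e_def)
  qed
  have c_le: "c x + b n x \<le> a n x + e n x" for n x
  proof -
    have "riesz_potential \<beta> (\<lambda>y. ennreal (\<bar>V y\<bar> powr p) + ennreal (\<bar>U n y - V y\<bar> powr p)) x
      \<le> riesz_potential \<beta> (\<lambda>y. ennreal (\<bar>U n y\<bar> powr p)
      + ennreal \<bar>\<bar>(U n y - V y) + V y\<bar> powr p - \<bar>V y\<bar> powr p - \<bar>U n y - V y\<bar> powr p\<bar>) x"
      by (intro riesz_potential_mono) (auto intro!: ennreal_leI simp flip: ennreal_plus)
    then show ?thesis by (simp add: riesz_potential_add a_def b_def c_def e_def)
  qed

  define C where "C = (SUP n. \<integral>\<^sup>+x. (a n x)\<^sup>2 \<partial>lborel)"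
  have C: "C < \<infinity>" and a_L2: "\<And>n. a n \<in> L2_ennreal"
    using assms(6) by (auto simp: bounded_in_L2_def a_eq C_def nn_integral_completion)
  have a2: "(\<integral>\<^sup>+x. (a n x)\<^sup>2 \<partial>lborel) \<le> C" for n
    unfolding C_def by (rule SUP_upper) simp
  have c2: "(\<integral>\<^sup>+x. (c x)\<^sup>2 \<partial>lborel) \<le> C"
    unfolding c_def
  proof (rule nn_integral_riesz_potential_power2_le)
    show "AE y in lborel. (\<lambda>n. ennreal (\<bar>U n y\<bar> powr p)) \<longlonglongrightarrow> ennreal (\<bar>V y\<bar> powr p)"
      using limV
      by eventually_elim (use p in \<open>auto intro!: tendsto_ennrealI tendsto_powr' tendsto_rabs\<close>)
    show "(\<integral>\<^sup>+x. (riesz_potential \<beta> (\<lambda>y. ennreal (\<bar>U n y\<bar> powr p)) x)\<^sup>2 \<partial>lborel) \<le> C" for n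
      using a2[of n] by (simp add: a_def)
  qed auto
  have c2_fin: "(\<integral>\<^sup>+x. (c x)\<^sup>2 \<partial>lborel) < \<infinity>" using c2 C by (rule le_less_trans)
  define B where "B = (ennreal (2 powr p))\<^sup>2 * (2 * C + 2 * C)"
  have B: "B < \<infinity>" using C by (simp add: B_def ennreal_mult_less_top ennreal_power)
  have b2: "(\<integral>\<^sup>+x. (b n x)\<^sup>2 \<partial>lborel) \<le> B" for n
    unfolding b_def B_def
    using a2[of n] c2 by (intro nn_integral_riesz_potential_diff_powr_bounded p) (auto simp: a_def c_def)

  have lim0: "AE x in lborel. (\<lambda>n. U n x - V x) \<longlonglongrightarrow> 0"
    using limV by eventually_elim (simp add: LIM_zero)
  have e2: "(\<lambda>n. \<integral>\<^sup>+x. (e n x)\<^sup>2 \<partial>lborel) \<longlonglongrightarrow> 0"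
    unfolding e_def
    by (rule riesz_potential_powr_defect_tendsto_0[OF p _ _ lim0, where C = B])
       (use b2 c2_fin B in \<open>auto simp: b_def c_def\<close>)
  have loc: "\<exists>C'<\<infinity>. \<forall>n. (\<integral>\<^sup>+x. ennreal (\<bar>U n x - V x\<bar> powr q) * indicator (ball 0 M) x \<partial>lborel) \<le> C'" for M
  proof -
    define C' where "C' = (SUP n. \<integral>\<^sup>+x. ennreal (\<bar>u n x\<bar> powr q) * indicator (cball 0 M) x \<partial>lborel)"
    have C': "C' < \<infinity>"
      using Lq by (simp add: bounded_in_Lq_loc_def C'_def nn_integral_completion)
    have "(\<integral>\<^sup>+x. ennreal (\<bar>U n x\<bar> powr q) * indicator (ball 0 M) x \<partial>lborel) \<le> C'" for n
    proof -
      have "(\<integral>\<^sup>+x. ennreal (\<bar>U n x\<bar> powr q) * indicator (ball 0 M) x \<partial>lborel)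
          \<le> (\<integral>\<^sup>+x. ennreal (\<bar>u n x\<bar> powr q) * indicator (cball 0 M) x \<partial>lborel)"
        using uU[of n] by (intro nn_integral_mono_AE) (auto simp: indicator_def)
      also have "\<dots> \<le> C'" unfolding C'_def by (rule SUP_upper) simp
      finally show ?thesis .
    qed
    then have "\<forall>n. (\<integral>\<^sup>+x. ennreal (\<bar>U n x - V x\<bar> powr q) * indicator (ball 0 M) x \<partial>lborel)
        \<le> ennreal (2 powr q) * (C' + C')"
      using p q limV by (intro allI nn_integral_diff_powr_bounded) auto
    moreover have "ennreal (2 powr q) * (C' + C') < \<infinity>" using C' by (simp add: ennreal_mult_less_top)
    ultimately show ?thesis by blast
  qed
  have weak0: "(\<lambda>n. \<integral>\<^sup>+x. \<phi> x * b n x \<partial>lebesgue) \<longlonglongrightarrow> 0"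
    if "\<phi> \<in> borel_measurable lebesgue" "(\<integral>\<^sup>+x. (\<phi> x)\<^sup>2 \<partial>lebesgue) < \<infinity>" for \<phi>
    unfolding b_def
    by (rule riesz_potential_powr_weakly_null[OF \<beta> p q _ lim0 _ B loc that]) (use b2 in \<open>auto simp: b_def\<close>)

  have "c \<in> L2_ennreal" using c2_fin by (simp add: L2_ennreal_def nn_integral_completion)
  moreover have "(\<lambda>n. \<integral>x. enn2real (a n x) * \<phi> x \<partial>lebesgue) \<longlonglongrightarrow> (\<integral>x. enn2real (c x) * \<phi> x \<partial>lebesgue)"
    if "\<phi> \<in> L2_real" for \<phi>
  proof (rule weak_limit_if_remainders_null[OF meas(1,2,4,3) _ a_le c_le])
    show \<phi> [measurable]: "\<phi> \<in> borel_measurable lebesgue" using that by (simp add: L2_real_def)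
    show \<phi>2: "(\<integral>\<^sup>+x. (ennreal \<bar>\<phi> x\<bar>)\<^sup>2 \<partial>lebesgue) < \<infinity>"
      using that by (simp add: L2_real_def integrable_iff_bounded ennreal_power)
    show "(\<lambda>n. \<integral>\<^sup>+x. ennreal \<bar>\<phi> x\<bar> * b n x \<partial>lebesgue) \<longlonglongrightarrow> 0"
      by (rule weak0) (use \<phi>2 in auto)
  qed (use a_L2 c2_fin e2 in \<open>auto simp: L2_ennreal_def nn_integral_completion\<close>)
  moreover have "(\<lambda>n. \<integral>\<^sup>+x. ennreal_absdiff ((a n x)\<^sup>2) ((b n x)\<^sup>2) \<partial>lebesgue)
      \<longlonglongrightarrow> (\<integral>\<^sup>+x. (c x)\<^sup>2 \<partial>lebesgue)"
    by (rule nn_integral_absdiff_power2_tendsto[OF meas(1,2,4,3) a_le c_le _ B _ _ weak0])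
       (use b2 c2_fin e2 in \<open>auto simp: nn_integral_completion\<close>)
  ultimately show ?thesis
    unfolding a_eq b_eq c_eq weakly_converges_L2_def using a_L2 by blast
qed

end
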